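(* For a bounded function $u_0:\mathbb{Z}^d\to\mathbb{R}$ let $u^\star(n)=\sup_{y\in\mathbb{Z}^+}(|u_0|*\mathcal{P}_y)(n)$, $n\in\mathbb{Z}^d$, be its discrete Poisson maximal function, where $\mathbb{Z}^+=\{0,1,2,\dots\}$ and $\mathcal{P}_y$ is the discrete Poisson kernel on $\mathbb{Z}^d$. The following hold. (i) Let $d=1$, $1\le p\le\infty$ and let $u_0:\mathbb{Z}\to\mathbb{R}$ be a bounded function such that $\|u_0'\|_p<\infty$. Then $\|(u^\star)'\|_p\le\|u_0'\|_p$. (ii) Let $d\ge1$ and let $u_0:\mathbb{Z}^d\to\mathbb{R}$ be a bounded function such that $\|\nabla u_0\|_2<\infty$. Then $\|\nabla u^\star\|_2\le\|\nabla u_0\|_2$.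
   Context: For bounded $f:\mathbb{Z}^d\to\mathbb{R}$, $\partial_{x_i}f(n)=f(n+e_i)-f(n)$, where $e_i$ is the $i$-th canonical basis vector, and $\nabla f(n)=(\partial_{x_1}f(n),\dots,\partial_{x_d}f(n))$; for $d=1$ write $f'(n)=f(n+1)-f(n)$. For $1\le p<\infty$, $\|f\|_p=\big(\sum_{n\in\mathbb{Z}^d}|f(n)|^p\big)^{1/p}$, and $\|f\|_\infty=\sup_{n}|f(n)|$; $\|\nabla f\|_p$ is the $l^p(\mathbb{Z}^d)$-norm of $n\mapsto|\nabla f(n)|$ with $|\cdot|$ the Euclidean norm. The discrete Poisson kernel is defined as follows. With $\mathbb{T}^d=[-\tfrac12,\tfrac12]^d$ and $\xi=(\xi_1,\dots,\xi_d)\in\mathbb{T}^d$, put $S(\xi)=(d+1)-\sum_{k=1}^d\cos(2\pi\xi_k)$, $\widehat{\mathcal{P}_1}(\xi)=S(\xi)-\big(S(\xi)^2-1\big)^{1/2}\in(0,1]$, $\widehat{\mathcal{P}_y}(\xi)=\big(\widehat{\mathcal{P}_1}(\xi)\big)^y$ for $y\ge0$, and $\mathcal{P}_y(n)=\int_{\mathbb{T}^d}\widehat{\mathcal{P}_y}(\xi)\,e^{2\pi i\,n\cdot\xi}\,d\xi$ for $n\in\mathbb{Z}^d$. For $y\in\mathbb{Z}^+$ the kernel $\mathcal{P}_y$ is nonnegative with $\sum_{n\in\mathbb{Z}^d}\mathcal{P}_y(n)=1$, so the convolution $(|u_0|*\mathcal{P}_y)(n)=\sum_{m\in\mathbb{Z}^d}|u_0(n-m)|\,\mathcal{P}_y(m)$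 is well defined. *)

theory Defs
  imports "HOL-Analysis.Analysis"
begin

definition diff1 :: "(int \<Rightarrow> real) \<Rightarrow> int \<Rightarrow> real" where
  "diff1 f n = f (n + 1) - f n"

definition partial_diff :: "'d::finite \<Rightarrow> (int ^ 'd \<Rightarrow> real) \<Rightarrow> int ^ 'd \<Rightarrow> real" where
  "partial_diff i f n = f (n + axis i 1) - f n"

definition grad :: "(int ^ 'd::finite \<Rightarrow> real) \<Rightarrow> int ^ 'd \<Rightarrow> real ^ 'd" where
  "grad f n = (\<chi> i. partial_diff i f n)"

text \<open>
  The value is \<open>\<infinity>\<close> when the defining series diverges or the supremum is not finite.
  The definition is meant for \<open>1 \<le> p\<close>, and covers scalar and vector-valued functions
  (the latter measured in the Euclidean norm).
\<close>
definition lp_norm :: "ennreal \<Rightarrow> ('n \<Rightarrow> 'b::real_normed_vector) \<Rightarrow> ennreal" where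
  "lp_norm p f =
     (if p = \<infinity> then (SUP n. ennreal (norm (f n)))
      else if (\<lambda>n. norm (f n) powr enn2real p) summable_on UNIV
      then ennreal ((\<Sum>\<^sub>\<infinity>n. norm (f n) powr enn2real p) powr (1 / enn2real p))
      else \<infinity>)"

definition poisson_S :: "real ^ 'd::finite \<Rightarrow> real" where
  "poisson_S \<xi> = (real CARD('d) + 1) - (\<Sum>k\<in>UNIV. cos (2 * pi * \<xi> $ k))"

definition poisson_hat1 :: "real ^ 'd::finite \<Rightarrow> real" where
  "poisson_hat1 \<xi> = poisson_S \<xi> - sqrt ((poisson_S \<xi>)\<^sup>2 - 1)"

definition poisson_hat :: "real \<Rightarrow> real ^ 'd::finite \<Rightarrow> real" where
  "poisson_hat y \<xi> = poisson_hat1 \<xi> powr y"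

definition torus :: "(real ^ 'd::finite) set" where
  "torus = cbox (\<chi> i. - 1 / 2) (\<chi> i. 1 / 2)"

definition poisson_kernel_complex :: "real \<Rightarrow> int ^ 'd::finite \<Rightarrow> complex" where
  "poisson_kernel_complex y n =
     integral torus (\<lambda>\<xi>. of_real (poisson_hat y \<xi>) *
       exp (2 * of_real pi * \<i> * of_real (\<Sum>k\<in>UNIV. of_int (n $ k) * \<xi> $ k)))"

text \<open>The integral is real, as shown below in \<open>of_real_poisson_kernel\<close>.\<close>
definition poisson_kernel :: "real \<Rightarrow> int ^ 'd::finite \<Rightarrow> real" where
  "poisson_kernel y n = Re (poisson_kernel_complex y n)"

definition convolution :: "('n::ab_group_add \<Rightarrow> real) \<Rightarrow> ('n \<Rightarrow> real) \<Rightarrow> 'n \<Rightarrow> real" where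
  "convolution f g n = (\<Sum>\<^sub>\<infinity>m. f (n - m) * g m)"

definition poisson_max :: "(int ^ 'd::finite \<Rightarrow> real) \<Rightarrow> int ^ 'd \<Rightarrow> real" where
  "poisson_max u n = (SUP y::nat. convolution (\<lambda>m. \<bar>u m\<bar>) (poisson_kernel (real y)) n)"

text \<open>The case \<open>d = 1\<close>, with \<open>int\<close> identified with \<open>int ^ 1\<close>.\<close>
definition poisson_max1 :: "(int \<Rightarrow> real) \<Rightarrow> int \<Rightarrow> real" where
  "poisson_max1 u n = poisson_max (\<lambda>m :: int ^ 1. u (m $ 1)) (vec n)"

lemma poisson_S_ge_1: "poisson_S \<xi> \<ge> 1"
proof -
  have "(\<Sum>k\<in>UNIV. cos (2 * pi * \<xi> $ k)) \<le> (\<Sum>k\<in>(UNIV::'a set). 1)"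
    by (intro sum_mono) auto
  then show ?thesis by (simp add: poisson_S_def)
qed

lemma poisson_hat1_pos: "poisson_hat1 \<xi> > 0"
proof -
  have "sqrt ((poisson_S \<xi>)\<^sup>2 - 1) < sqrt ((poisson_S \<xi>)\<^sup>2)"
    by (intro real_sqrt_less_mono) simp
  also have "\<dots> = poisson_S \<xi>"
    using poisson_S_ge_1[of \<xi>] by simp
  finally show ?thesis by (simp add: poisson_hat1_def)
qed

lemma poisson_hat1_le_1: "poisson_hat1 \<xi> \<le> 1"
proof -
  let ?s = "poisson_S \<xi>"
  have "(?s - 1)\<^sup>2 \<le> ?s\<^sup>2 - 1"
    using poisson_S_ge_1[of \<xi>] by (simp add: power2_eq_square algebra_simps)
  then have "?s - 1 \<le> sqrt (?s\<^sup>2 - 1)"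
    by (rule real_le_rsqrt)
  then show ?thesis by (simp add: poisson_hat1_def)
qed

lemma poisson_hat_uminus: "poisson_hat y (- \<xi>) = poisson_hat y \<xi>"
  by (simp add: poisson_hat_def poisson_hat1_def poisson_S_def)

lemma continuous_on_poisson_hat: "continuous_on A (poisson_hat y)"
proof -
  have "continuous_on A poisson_hat1"
    unfolding poisson_hat1_def poisson_S_def by (intro continuous_intros)
  then show ?thesis
    unfolding poisson_hat_def
    by (intro continuous_on_powr continuous_on_const) (auto simp: poisson_hat1_pos less_imp_neq[symmetric])
qed

lemma of_real_poisson_kernel: "of_real (poisson_kernel y n) = poisson_kernel_complex y n"
proof -
  let ?f = "\<lambda>\<xi>. of_real (poisson_hat y \<xi>) *
       exp (2 * of_real pi * \<i> * of_real (\<Sum>k\<in>UNIV. of_int (n $ k) * \<xi> $ k)) :: complex"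
  have torus_eq: "(torus :: (real ^ 'a) set) = cbox (- (\<chi> i. 1 / 2)) (\<chi> i. 1 / 2 )"
    by (simp add: torus_def vec_eq_iff arg_cong2[where f = cbox])
  have cnj_f: "?f (- \<xi>) = cnj (?f \<xi>)" for \<xi>
    by (simp add: poisson_hat_uminus exp_cnj sum_negf)
  have "integral torus ?f = integral torus (\<lambda>\<xi>. ?f (- \<xi>))"
    unfolding torus_eq
    using integral_reflect[of "\<chi> i. 1 / 2" "- (\<chi> i. 1 / 2)" ?f] by (simp only: minus_minus)
  also have "\<dots> = integral torus (\<lambda>\<xi>. cnj (?f \<xi>))"
    by (simp only: cnj_f)
  also have "\<dots> = cnj (integral torus ?f)"
    by (rule integral_cnj[symmetric])
  finally have "poisson_kernel_complex y n = cnj (poisson_kernel_complex y n)"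
    by (simp only: poisson_kernel_complex_def)
  then have "Im (poisson_kernel_complex y n) = 0"
    by (metis complex_cnj cnj.simps(2) neg_equal_zero)
  then show ?thesis by (simp add: poisson_kernel_def complex_eq_iff)
qed

end

theory Submission
  imports Defs
begin

text \<open>
  Extended by \<open>y\<close>, the function \<open>u(n, y) = (f * P\<^sub>y)(n)\<close> with \<open>f = |u\<^sub>0|\<close> is discrete
  harmonic on the half space, with boundary values \<open>f\<close>. It is the increasing limit, as \<open>t\<close> grows,
  of the averages \<open>u\<^sub>t\<close> of \<open>f\<close> over the exit points of a simple random walk that has left the
  half space by time \<open>t\<close>. The truncated maximal function \<open>M\<^sub>t(n) = sup\<^sub>y u\<^sub>t(n, y)\<close> is
  subharmonic wherever it exceeds \<open>f\<close>, and \<open>M\<^sub>t - f\<close> lies in \<open>l\<^sup>p\<close> because the truncated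
  averages have finite range, so the convexity of \<open>|x|\<^sup>p\<close> and a summation by parts without
  boundary terms give \<open>\<parallel>\<nabla>M\<^sub>t\<parallel>\<^sub>p \<le> \<parallel>\<nabla>f\<parallel>\<^sub>p\<close> when \<open>p = 2\<close> or \<open>d = 1\<close>; then \<open>t\<close> tends to
  infinity. For \<open>p = \<infinity>\<close> averaging preserves Lipschitz bounds.

  The Fourier symbol of \<open>u\<^sub>t(\<cdot>, y)\<close> satisfies a recursion in \<open>t\<close> and \<open>y\<close> whose stationary solution is
  \<open>z\<^sup>y\<close>, with \<open>z\<close> the root of \<open>z + 1/z = 2 S(\<xi>)\<close> in \<open>(0, 1]\<close>. The error is at most the probability that
  the walk has not yet left the half space, which tends to \<open>0\<close> uniformly in \<open>\<xi>\<close>.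
\<close>

subsection \<open>The symbol of the stopped random walk\<close>

text \<open>Of interest is \<open>c = cos (2 \<pi> \<xi>\<^sub>1) + \<dots> + cos (2 \<pi> \<xi>\<^sub>d)\<close>; the value at \<open>c = d\<close>, i.e. \<open>\<xi> = 0\<close>,
  is the probability that the walk started at height \<open>y\<close> has reached height \<open>0\<close> by time \<open>t\<close>.\<close>
fun walk_symbol :: "real \<Rightarrow> real \<Rightarrow> nat \<Rightarrow> nat \<Rightarrow> real" where
  "walk_symbol d c t 0 = 1"
| "walk_symbol d c 0 (Suc y) = 0"
| "walk_symbol d c (Suc t) (Suc y) =
    (walk_symbol d c t (Suc (Suc y)) + walk_symbol d c t y
        + 2 * c * walk_symbol d c t (Suc y)) / (2 * (d + 1))"


text \<open>At \<open>c = d\<close> the recursion is a convex combination: the weights 1, 1 and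
  \<open>2 * d\<close> add up to the denominator \<open>2 * (d + 1)\<close>.\<close>

lemma walk_symbol_diag_bounds:
  assumes "d \<ge> 0"
  shows "0 \<le> walk_symbol d d t y \<and> walk_symbol d d t y \<le> 1"
proof (induction t arbitrary: y)
  case 0
  then show ?case by (cases y) auto
next
  case (Suc t)
  show ?case
  proof (cases y)
    case (Suc z)
    have "2 * d * walk_symbol d d t (Suc z) \<le> 2 * d * 1"
      using Suc.IH assms by (intro mult_left_mono) auto
    moreover have "walk_symbol d d t (Suc (Suc z)) \<le> 1" "walk_symbol d d t z \<le> 1"
      using Suc.IH by auto
    ultimately have "walk_symbol d d t (Suc (Suc z)) + walk_symbol d d t z
        + 2 * d * walk_symbol d d t (Suc z) \<le> 2 * (d + 1)"
      by (simp add: algebra_simps)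
    then show ?thesis
      using Suc Suc.IH assms by (simp add: divide_simps)
  qed simp
qed

lemma walk_symbol_diag_mono:
  assumes "d \<ge> 0"
  shows "walk_symbol d d t y \<le> walk_symbol d d (Suc t) y"
proof (induction t arbitrary: y)
  case 0
  then show ?case
    using walk_symbol_diag_bounds[OF assms, of "Suc 0" y] by (cases y) auto
next
  case (Suc t)
  show ?case
  proof (cases y)
    case (Suc z)
    have "walk_symbol d d (Suc t) (Suc z) = (walk_symbol d d t (Suc (Suc z))
        + walk_symbol d d t z + 2 * d * walk_symbol d d t (Suc z)) / (2 * (d + 1))"
      by (rule walk_symbol.simps)
    also have "\<dots> \<le> (walk_symbol d d (Suc t) (Suc (Suc z))
        + walk_symbol d d (Suc t) z + 2 * d * walk_symbol d d (Suc t) (Suc z)) / (2 * (d + 1))"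
      using assms by (intro divide_right_mono add_mono mult_left_mono Suc.IH)
        (simp_all del: walk_symbol.simps)
    also have "\<dots> = walk_symbol d d (Suc (Suc t)) (Suc z)"
      by (rule walk_symbol.simps[symmetric])
    finally show ?thesis
      unfolding Suc .
  qed simp
qed

text \<open>The limit is a bounded function of \<open>y\<close> with vanishing second differences, hence constant.\<close>
lemma walk_symbol_diag_tendsto_1:
  assumes "d \<ge> 0"
  shows "(\<lambda>t. walk_symbol d d t y) \<longlonglongrightarrow> 1"
proof -
  define L where "L y = lim (\<lambda>t. walk_symbol d d t y)" for y
  have conv: "(\<lambda>t. walk_symbol d d t y) \<longlonglongrightarrow> L y" for y
  proof -
    have "incseq (\<lambda>t. walk_symbol d d t y)"
      using walk_symbol_diag_mono[OF assms] by (intro incseq_SucI)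
    then obtain l where "(\<lambda>t. walk_symbol d d t y) \<longlonglongrightarrow> l"
      by (rule incseq_convergent[where B = 1]) (use walk_symbol_diag_bounds[OF assms] in auto)
    then show ?thesis
      unfolding L_def by (simp add: limI)
  qed
  have L_bounds: "0 \<le> L y \<and> L y \<le> 1" for y
    using walk_symbol_diag_bounds[OF assms]
    by (intro conjI LIMSEQ_le_const[OF conv] LIMSEQ_le_const2[OF conv]) auto
  have L0: "L 0 = 1"
    using conv[of 0] by (simp add: LIMSEQ_const_iff)
  have rec: "L (Suc (Suc y)) = 2 * L (Suc y) - L y" for y
  proof -
    have "(\<lambda>t. walk_symbol d d (Suc t) (Suc y)) \<longlonglongrightarrow>
        (L (Suc (Suc y)) + L y + 2 * d * L (Suc y)) / (2 * (d + 1))"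
      unfolding walk_symbol.simps by (intro tendsto_intros conv) (use assms in auto)
    then have "L (Suc y) = (L (Suc (Suc y)) + L y + 2 * d * L (Suc y)) / (2 * (d + 1))"
      using LIMSEQ_Suc[OF conv[of "Suc y"]] LIMSEQ_unique by blast
    then show ?thesis using assms by (simp add: field_simps)
  qed
  define a where "a = 1 - L (Suc 0)"
  have L1: "L (Suc 0) = 1 - a" by (simp add: a_def)
  have lin: "L y = 1 - real y * a \<and> L (Suc y) = 1 - real (Suc y) * a" for y
    by (induction y) (simp_all add: L0 L1 rec algebra_simps)
  \<comment> \<open>The upper bound at height 1 rules out a negative \<open>a\<close>; a positive
    \<open>a\<close> would push \<open>L k\<close> below 0 for large \<open>k\<close>.\<close>
  have "a \<ge> 0" using L_bounds[of "Suc 0"] by (simp add: a_def)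
  moreover have "\<not> a > 0"
  proof
    assume "a > 0"
    then obtain k :: nat where "1 < real k * a"
      using reals_Archimedean3 by blast
    then show False
      using lin[of k] L_bounds[of k] by auto
  qed
  ultimately have "L y = 1" using lin[of y] by simp
  then show ?thesis using conv[of y] by simp
qed

text \<open>By \<open>root\<close>, \<open>z ^ y\<close> is a stationary solution of the recursion,
  so its difference from the symbol obeys the same recursion and vanishes at height 0. As
  \<open>\<bar>c\<bar> \<le> d\<close>, the absolute value of this difference is dominated by the
  solution for \<open>c = d\<close>, and \<open>1 - walk_symbol d d t y\<close> is one because
  constants are stationary there.\<close>

lemma power_diff_walk_symbol_le:
  fixes z c d :: real
  assumes d: "d \<ge> 0" and c: "\<bar>c\<bar> \<le> d" and z: "0 \<le> z" "z \<le> 1"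
    and root: "z\<^sup>2 + 1 = 2 * (d + 1 - c) * z"
  shows "\<bar>z ^ y - walk_symbol d c t y\<bar> \<le> 1 - walk_symbol d d t y"
proof (induction t arbitrary: y)
  case 0
  then show ?case using z zero_le_power[of z y] power_le_one[of z y] by (cases y) (auto simp: abs_le_iff)
next
  case (Suc t)
  show ?case
  proof (cases y)
    case (Suc v)
    define D where "D y = z ^ y - walk_symbol d c t y" for y
    define E where "E y = 1 - walk_symbol d d t y" for y
    have DE: "\<bar>D y\<bar> \<le> E y" for y
      using Suc.IH by (simp add: D_def E_def)
    have zrec: "2 * (d + 1) * z ^ Suc v = z ^ Suc (Suc v) + z ^ v + 2 * c * z ^ Suc v"
    proof -
      have "z ^ v * (z\<^sup>2 + 1) = z ^ v * (2 * (d + 1 - c) * z)" by (simp only: root)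
      then show ?thesis by (simp add: algebra_simps power2_eq_square)
    qed
    have *: "\<bar>D (Suc (Suc v)) + D v + 2 * c * D (Suc v)\<bar>
        \<le> E (Suc (Suc v)) + E v + 2 * d * E (Suc v)"
    proof -
      have "\<bar>2 * c * D (Suc v)\<bar> \<le> 2 * d * E (Suc v)"
        unfolding abs_mult using c DE[of "Suc v"] d by (intro mult_mono) auto
      then show ?thesis using DE[of v] DE[of "Suc (Suc v)"] by linarith
    qed
    have "D (Suc (Suc v)) + D v + 2 * c * D (Suc v) = 2 * (d + 1) * z ^ Suc v -
        (walk_symbol d c t (Suc (Suc v)) + walk_symbol d c t v + 2 * c * walk_symbol d c t (Suc v))"
      unfolding zrec D_def by (simp add: algebra_simps)
    then have "z ^ Suc v - walk_symbol d c (Suc t) (Suc v) =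
        (D (Suc (Suc v)) + D v + 2 * c * D (Suc v)) / (2 * (d + 1))"
      using d by (simp add: diff_divide_distrib)
    then have "\<bar>z ^ Suc v - walk_symbol d c (Suc t) (Suc v)\<bar> =
        \<bar>D (Suc (Suc v)) + D v + 2 * c * D (Suc v)\<bar> / (2 * (d + 1))"
      using d by (simp only: abs_divide) simp
    also have "\<dots> \<le> (E (Suc (Suc v)) + E v + 2 * d * E (Suc v)) / (2 * (d + 1))"
      using d * by (intro divide_right_mono) auto
    also have "\<dots> = 1 - walk_symbol d d (Suc t) (Suc v)"
      unfolding E_def walk_symbol.simps using d
      by (simp add: field_simps del: walk_symbol.simps)
    finally show ?thesis
      unfolding Suc .
  qed simp
qed

subsection \<open>Fourier inversion on the torus\<close>

definition phase :: "int ^ 'd::finite \<Rightarrow> real ^ 'd \<Rightarrow> real" where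
  "phase n \<xi> = 2 * pi * (\<Sum>k\<in>UNIV. of_int (n $ k) * \<xi> $ k)"

lemma phase_add: "phase (m + n) \<xi> = phase m \<xi> + phase n \<xi>"
  by (simp add: phase_def algebra_simps sum.distrib)

lemma phase_diff: "phase (m - n) \<xi> = phase m \<xi> - phase n \<xi>"
  by (simp add: phase_def algebra_simps sum_subtractf)

lemma phase_axis: "phase (axis k 1) \<xi> = 2 * pi * \<xi> $ k"
proof -
  have "(\<Sum>j\<in>UNIV. of_int (axis k 1 $ j) * \<xi> $ j) = (\<Sum>j\<in>UNIV. if j = k then \<xi> $ j else 0)"
    by (intro sum.cong) (auto simp: axis_def)
  then show ?thesis by (simp add: phase_def)
qed

lemma continuous_on_phase [continuous_intros]: "continuous_on A (phase n)"
  unfolding phase_def by (intro continuous_intros)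

text \<open>Fubini for a product of functions of one coordinate each. Lebesgue measure is the image
  of a product measure indexed by \<open>Basis\<close>, so the factors are reindexed along
  \<open>k \<mapsto> axis k 1\<close>.\<close>

lemma integral_lborel_prod_vec:
  fixes h :: "'d::finite \<Rightarrow> real \<Rightarrow> complex"
  assumes h: "\<And>k. integrable lborel (h k)"
  shows "(\<integral>\<xi>. (\<Prod>k\<in>UNIV. h k (\<xi> $ k)) \<partial>(lborel :: (real ^ 'd) measure)) = (\<Prod>k\<in>UNIV. \<integral>x. h k x \<partial>lborel)"
proof -
  interpret product_sigma_finite "\<lambda>_ :: real ^ 'd. lborel :: real measure"
    by standard
  have [measurable]: "h k \<in> borel_measurable borel" for k
    using borel_measurable_integrable[OF h] by simp
  have Basis_eq: "(Basis :: (real ^ 'd) set) = (\<lambda>k. axis k 1) ` UNIV"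
    by (auto simp: Basis_vec_def)
  have inj: "inj (\<lambda>k :: 'd. axis k (1 :: real))"
    by (auto simp: inj_on_def axis_eq_axis)
  have prod_Basis: "(\<Prod>k\<in>UNIV. G k) = (\<Prod>b\<in>(Basis :: (real ^ 'd) set). G (axis_index b))"
    for G :: "'d \<Rightarrow> complex"
    unfolding Basis_eq by (subst prod.reindex[OF inj]) simp
  have coord: "(\<Sum>b\<in>Basis. f b *\<^sub>R b) $ k = f (axis k 1)" for f :: "real ^ 'd \<Rightarrow> real" and k
    by (simp add: cart_eq_inner_axis[of _ k] inner_sum_left_Basis)
  have "(\<integral>\<xi>. (\<Prod>k\<in>UNIV. h k (\<xi> $ k)) \<partial>(lborel :: (real ^ 'd) measure))
      = (\<integral>f. (\<Prod>k\<in>UNIV. h k ((\<Sum>b\<in>Basis. f b *\<^sub>R b) $ k)) \<partial>(\<Pi>\<^sub>M b\<in>(Basis :: (real ^ 'd) set). lborel))"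
    by (subst lborel_eq, subst integral_distr) simp_all
  also have "\<dots> = (\<integral>f. (\<Prod>b\<in>Basis. h (axis_index b) (f b)) \<partial>(\<Pi>\<^sub>M b\<in>(Basis :: (real ^ 'd) set). lborel))"
    unfolding coord prod_Basis
    by (intro Bochner_Integration.integral_cong refl prod.cong) (auto simp: Basis_vec_def)
  also have "\<dots> = (\<Prod>b\<in>(Basis :: (real ^ 'd) set). \<integral>x. h (axis_index b) x \<partial>lborel)"
    by (rule product_integral_prod) (use h in auto)
  also have "\<dots> = (\<Prod>k\<in>UNIV. \<integral>x. h k x \<partial>lborel)"
    by (rule prod_Basis[symmetric])
  finally show ?thesis .
qed

lemma integral_cis_period:
  fixes m :: int
  shows "integral {-1/2..1/2} (\<lambda>x. cis (2 * pi * m * x)) = (if m = 0 then 1 else 0)"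
proof (cases "m = 0")
  case False
  define F where "F x = cis (2 * pi * m * x) / (2 * pi * m * \<i>)" for x :: real
  have nz: "2 * complex_of_real pi * m * \<i> \<noteq> 0" using False by auto
  have "(F has_vector_derivative cis (2 * pi * m * x)) (at x within {-1/2..1/2})" for x
    unfolding F_def has_vector_derivative_def using nz
    by (auto intro!: derivative_eq_intros simp: fun_eq_iff scaleR_conv_of_real field_simps)
  then have "((\<lambda>x. cis (2 * pi * m * x)) has_integral F (1/2) - F (-1/2)) {-1/2..1/2}"
    by (intro fundamental_theorem_of_calculus) auto
  \<comment> \<open>The two values differ only in the sign of \<open>sin (pi * m)\<close>, which is
    0 for an integer \<open>m\<close>.\<close>
  moreover have "F (1/2) = F (-1/2)"
    by (simp add: F_def complex_eq_iff cis.ctr)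
  ultimately show ?thesis using False by (simp add: integral_unique)
qed simp

text \<open>Both the character and the indicator of the cube factor over the coordinates, which
  leaves a product of one-dimensional period integrals.\<close>

lemma integral_torus_cis_phase:
  "integral torus (\<lambda>\<xi>. cis (phase n \<xi>)) = (if n = 0 then 1 else 0)"
proof -
  let ?I = "{-1/2..1/2 :: real}"
  define h where "h k x = indicator ?I x *\<^sub>R cis (2 * pi * of_int (n $ k) * x)" for k x
  have int_h: "set_integrable lborel ?I (\<lambda>x. cis (2 * pi * of_int (n $ k) * x))" for k
    by (intro borel_integrable_atLeastAtMost' continuous_intros)
  have "set_integrable lborel torus (\<lambda>\<xi>. cis (phase n \<xi>))"
    unfolding set_integrable_def torus_def
    by (intro borel_integrable_compact compact_cbox continuous_intros)
  then have "integral torus (\<lambda>\<xi>. cis (phase n \<xi>)) = (\<integral>\<xi>. indicator torus \<xi> *\<^sub>R cis (phase n \<xi>) \<partial>lborel)"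
    by (simp add: set_borel_integral_eq_integral(2)[symmetric] set_lebesgue_integral_def)
  also have "(\<lambda>\<xi>. indicator torus \<xi> *\<^sub>R cis (phase n \<xi>)) = (\<lambda>\<xi>. \<Prod>k\<in>UNIV. h k (\<xi> $ k))"
  proof
    fix \<xi>
    have "cis (phase n \<xi>) = (\<Prod>k\<in>UNIV. cis (2 * pi * of_int (n $ k) * \<xi> $ k))"
      unfolding cis_conv_exp phase_def
      by (subst exp_sum[symmetric]) (auto simp: sum_distrib_left algebra_simps)
    moreover have "(indicator torus \<xi> :: real) = (\<Prod>k\<in>UNIV. indicator ?I (\<xi> $ k))"
    proof (cases "\<xi> \<in> torus")
      case True
      then show ?thesis by (auto simp: torus_def mem_box_cart intro!: prod.neutral[symmetric])
    next
      case False
      then obtain k where "\<xi> $ k \<notin> ?I" by (auto simp: torus_def mem_box_cart)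
      then show ?thesis using False by (subst prod_zero) (auto intro!: exI[of _ k])
    qed
    ultimately show "indicator torus \<xi> *\<^sub>R cis (phase n \<xi>) = (\<Prod>k\<in>UNIV. h k (\<xi> $ k))"
      by (simp add: h_def scaleR_conv_of_real prod.distrib)
  qed
  also have "(\<integral>\<xi>. (\<Prod>k\<in>UNIV. h k (\<xi> $ k)) \<partial>lborel) = (\<Prod>k\<in>UNIV. \<integral>x. h k x \<partial>lborel)"
    by (rule integral_lborel_prod_vec) (use int_h in \<open>simp add: h_def set_integrable_def\<close>)
  also have "\<dots> = (\<Prod>k\<in>UNIV. if n $ k = 0 then 1 else 0)"
    using set_borel_integral_eq_integral(2)[OF int_h] integral_cis_period[of "n $ k" for k]
    by (intro prod.cong) (simp_all add: h_def set_lebesgue_integral_def)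
  also have "\<dots> = (if n = 0 then 1 else 0)"
    by (auto simp: vec_eq_iff intro!: prod_zero)
  finally show ?thesis .
qed

lemma integrable_on_torus: "continuous_on torus f \<Longrightarrow> f integrable_on torus"
  for f :: "real ^ 'd::finite \<Rightarrow> 'b::banach"
  unfolding torus_def by (rule integrable_continuous)

lemma integral_torus_cos_phase:
  "integral torus (\<lambda>\<xi>. cos (phase n \<xi>)) = of_bool (n = 0)"
proof -
  have "integral torus (\<lambda>\<xi>. Re (cis (phase n \<xi>))) = Re (integral torus (\<lambda>\<xi>. cis (phase n \<xi>)))"
    using integral_linear[OF integrable_on_torus bounded_linear_Re, of "\<lambda>\<xi>. cis (phase n \<xi>)"]
    by (simp add: o_def continuous_intros)
  then show ?thesis by (simp add: integral_torus_cis_phase)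
qed

text \<open>The volume of the torus is read off from orthogonality at \<open>n = 0\<close>.\<close>

lemma integral_torus_const: "integral torus (\<lambda>_ :: real ^ 'd::finite. c :: real) = c"
proof -
  have "integral torus (\<lambda>\<xi> :: real ^ 'd. c * cos (phase 0 \<xi>)) = c"
    by (simp only: integral_mult_right integral_torus_cos_phase) simp
  then show ?thesis by (simp add: phase_def)
qed

subsection \<open>The Poisson kernel as a limit of walk kernels\<close>

text \<open>Expected value of \<open>f\<close> at the exit point of a walk started at
  \<open>(n, y)\<close>, where walks still running at time \<open>t\<close> contribute 0. The
  divisor is the number of neighbours in dimension d + 1: two vertical ones and two for each
  horizontal direction.\<close>

fun walk_average :: "(int ^ 'd::finite \<Rightarrow> real) \<Rightarrow> nat \<Rightarrow> nat \<Rightarrow> int ^ 'd \<Rightarrow> real" where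
  "walk_average f t 0 n = f n"
| "walk_average f 0 (Suc y) n = 0"
| "walk_average f (Suc t) (Suc y) n =
    (walk_average f t (Suc (Suc y)) n + walk_average f t y n +
      (\<Sum>k\<in>UNIV. walk_average f t (Suc y) (n + axis k 1) + walk_average f t (Suc y) (n - axis k 1)))
    / (2 * (real CARD('d) + 1))"

definition cos_sum :: "real ^ 'd::finite \<Rightarrow> real" where
  "cos_sum \<xi> = (\<Sum>k\<in>UNIV. cos (2 * pi * \<xi> $ k))"

lemma abs_cos_sum_le: "\<bar>cos_sum \<xi>\<bar> \<le> real CARD('d)" for \<xi> :: "real ^ 'd::finite"
proof -
  have "\<bar>cos_sum \<xi>\<bar> \<le> (\<Sum>k\<in>(UNIV :: 'd set). 1)"
    unfolding cos_sum_def by (rule order_trans[OF sum_abs]) (intro sum_mono, simp)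
  then show ?thesis by simp
qed

lemma continuous_on_cos_sum [continuous_intros]: "continuous_on A cos_sum"
  unfolding cos_sum_def by (intro continuous_intros)

lemma continuous_on_walk_symbol [continuous_intros]:
  "continuous_on A (\<lambda>\<xi>. walk_symbol d (cos_sum \<xi>) t y)"
proof (induction t arbitrary: y)
  case 0
  then show ?case by (cases y) auto
next
  case (Suc t)
  show ?case
  proof (cases y)
    case y: (Suc v)
    show ?thesis
      unfolding y walk_symbol.simps divide_inverse by (intro continuous_intros Suc.IH)
  qed simp
qed

text \<open>The walk average of the point mass at the origin; by symmetry of the walk, this is the
  law of the horizontal displacement at an exit by time \<open>t\<close>.\<close>

abbreviation walk_kernel :: "nat \<Rightarrow> nat \<Rightarrow> int ^ 'd::finite \<Rightarrow> real" where
  "walk_kernel \<equiv> walk_average (\<lambda>n. of_bool (n = 0))"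

text \<open>Induction on time. Since \<open>cos (a + b) + cos (a - b) = 2 * cos a * cos b\<close>,
  summing over the horizontal neighbours multiplies the symbol by \<open>2 * cos_sum \<xi>\<close>,
  which is the term with \<open>c\<close> in \<open>walk_symbol\<close>.\<close>

lemma walk_kernel_eq_integral:
  fixes n :: "int ^ 'd::finite"
  shows "walk_kernel t y n
      = integral torus (\<lambda>\<xi>. walk_symbol (real CARD('d)) (cos_sum \<xi>) t y * cos (phase n \<xi>))"
proof (induction t arbitrary: y n)
  case 0
  then show ?case by (cases y) (simp_all add: integral_torus_cos_phase)
next
  case (Suc t)
  show ?case
  proof (cases y)
    case 0
    then show ?thesis by (simp add: integral_torus_cos_phase)
  next
    case y: (Suc v)
    let ?s = "\<lambda>y \<xi> :: real ^ 'd. walk_symbol (real CARD('d)) (cos_sum \<xi>) t y"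
    let ?c = "\<lambda>n \<xi> :: real ^ 'd. cos (phase n \<xi>)"
    have int: "(\<lambda>\<xi>. ?s y \<xi> * ?c n \<xi>) integrable_on torus" for y n
      by (intro integrable_on_torus continuous_intros)
    have cos_phase: "2 * cos_sum \<xi> * ?c n \<xi> = (\<Sum>k\<in>UNIV. ?c (n + axis k 1) \<xi> + ?c (n - axis k 1) \<xi>)" for \<xi>
      by (simp add: phase_add phase_diff phase_axis cos_add cos_diff cos_sum_def sum_distrib_left
          sum_distrib_right sum.distrib mult_ac)
    have "walk_symbol (real CARD('d)) (cos_sum \<xi>) (Suc t) (Suc v) * ?c n \<xi> =
        (?s (Suc (Suc v)) \<xi> * ?c n \<xi> + ?s v \<xi> * ?c n \<xi> +
          (\<Sum>k\<in>UNIV. ?s (Suc v) \<xi> * ?c (n + axis k 1) \<xi> + ?s (Suc v) \<xi> * ?c (n - axis k 1) \<xi>))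
        / (2 * (real CARD('d) + 1))" for \<xi>
    proof -
      have "(\<Sum>k\<in>UNIV. ?s (Suc v) \<xi> * ?c (n + axis k 1) \<xi> + ?s (Suc v) \<xi> * ?c (n - axis k 1) \<xi>)
          = ?s (Suc v) \<xi> * (2 * cos_sum \<xi> * ?c n \<xi>)"
        unfolding cos_phase by (simp add: sum_distrib_left distrib_left)
      then show ?thesis by (simp add: algebra_simps)
    qed
    then show ?thesis
      unfolding y walk_average.simps Suc.IH
      by (simp only: integral_divide integral_add integral_sum int integrable_add integrable_sum finite)
  qed
qed

lemma poisson_kernel_eq_integral:
  "poisson_kernel (real y) n = integral torus (\<lambda>\<xi>. poisson_hat1 \<xi> ^ y * cos (phase n \<xi>))"
proof -
  let ?e = "\<lambda>\<xi>. 2 * of_real pi * \<i> * complex_of_real (\<Sum>k\<in>UNIV. of_int (n $ k) * \<xi> $ k)"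
  have cont: "continuous_on torus (\<lambda>\<xi>. complex_of_real (poisson_hat (real y) \<xi>) * exp (?e \<xi>))"
    by (intro continuous_intros continuous_on_poisson_hat)
  have e: "exp (?e \<xi>) = cis (phase n \<xi>)" for \<xi>
    by (simp add: cis_conv_exp phase_def mult_ac)
  have "poisson_kernel (real y) n =
      integral torus (\<lambda>\<xi>. Re (complex_of_real (poisson_hat (real y) \<xi>) * exp (?e \<xi>)))"
    unfolding poisson_kernel_def poisson_kernel_complex_def
    using integral_linear[OF integrable_on_torus[OF cont] bounded_linear_Re] by (simp only: o_def)
  also have "\<dots> = integral torus (\<lambda>\<xi>. poisson_hat1 \<xi> ^ y * cos (phase n \<xi>))"
    unfolding e by (simp add: poisson_hat_def powr_realpow poisson_hat1_pos)
  finally show ?thesis .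
qed

text \<open>\<open>poisson_hat1\<close> is the smaller root of
  \<open>z\<^sup>2 - 2 * S * z + 1\<close>; this supplies the assumption \<open>root\<close> of
  \<open>power_diff_walk_symbol_le\<close>.\<close>

lemma poisson_hat1_root:
  fixes \<xi> :: "real ^ 'd::finite"
  shows "(poisson_hat1 \<xi>)\<^sup>2 + 1 = 2 * (real CARD('d) + 1 - cos_sum \<xi>) * poisson_hat1 \<xi>"
proof -
  have "(sqrt ((poisson_S \<xi>)\<^sup>2 - 1))\<^sup>2 = (poisson_S \<xi>)\<^sup>2 - 1"
    using poisson_S_ge_1[of \<xi>] by (intro real_sqrt_pow2) simp
  moreover have "real CARD('d) + 1 - cos_sum \<xi> = poisson_S \<xi>"
    by (simp add: poisson_S_def cos_sum_def)
  ultimately show ?thesis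
    by (simp add: poisson_hat1_def power2_eq_square algebra_simps)
qed

text \<open>The bound on the difference of the symbols does not depend on the frequency, and the
  torus has mass 1, so the same bound holds for the kernels.\<close>

lemma poisson_kernel_diff_walk_kernel_le:
  fixes n :: "int ^ 'd::finite"
  shows "\<bar>poisson_kernel (real y) n - walk_kernel t y n\<bar>
      \<le> 1 - walk_symbol (real CARD('d)) (real CARD('d)) t y"
proof -
  let ?d = "real CARD('d)"
  have cont: "continuous_on torus (\<lambda>\<xi> :: real ^ 'd. poisson_hat1 \<xi> ^ y)"
    using continuous_on_poisson_hat[of torus "real y"]
    by (simp add: poisson_hat_def[abs_def] powr_realpow poisson_hat1_pos)
  have "poisson_kernel (real y) n - walk_kernel t y n
      = integral torus (\<lambda>\<xi>. poisson_hat1 \<xi> ^ y * cos (phase n \<xi>)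
          - walk_symbol ?d (cos_sum \<xi>) t y * cos (phase n \<xi>))"
    unfolding poisson_kernel_eq_integral walk_kernel_eq_integral
    by (intro integral_diff[symmetric] integrable_on_torus continuous_intros cont)
  also have "norm \<dots> \<le> integral torus (\<lambda>\<xi> :: real ^ 'd. 1 - walk_symbol ?d ?d t y)"
  proof (rule integral_norm_bound_integral)
    fix \<xi> :: "real ^ 'd"
    have "\<bar>poisson_hat1 \<xi> ^ y - walk_symbol ?d (cos_sum \<xi>) t y\<bar> * \<bar>cos (phase n \<xi>)\<bar>
        \<le> (1 - walk_symbol ?d ?d t y) * 1"
      using poisson_hat1_pos[of \<xi>] poisson_hat1_le_1[of \<xi>] poisson_hat1_root[of \<xi>] abs_cos_sum_le[of \<xi>]
        walk_symbol_diag_bounds[of ?d t y]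
      by (intro mult_mono power_diff_walk_symbol_le) auto
    then show "norm (poisson_hat1 \<xi> ^ y * cos (phase n \<xi>)
        - walk_symbol ?d (cos_sum \<xi>) t y * cos (phase n \<xi>))
        \<le> 1 - walk_symbol ?d ?d t y"
      by (simp only: left_diff_distrib[symmetric] abs_mult real_norm_def mult_1_right)
  qed (intro integrable_on_torus continuous_intros cont)+
  finally show ?thesis by (simp add: integral_torus_const)
qed

lemma walk_kernel_tendsto_poisson_kernel:
  "(\<lambda>t. walk_kernel t y n) \<longlonglongrightarrow> poisson_kernel (real y) n" for n :: "int ^ 'd::finite"
proof -
  have lim: "(\<lambda>t. 1 - walk_symbol (real CARD('d)) (real CARD('d)) t y) \<longlonglongrightarrow> 0"
    using tendsto_diff[OF tendsto_const walk_symbol_diag_tendsto_1[of "real CARD('d)" y], of 1]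
    by (simp only: of_nat_0_le_iff diff_self simp_thms)
  have bound: "norm (walk_kernel t y n - poisson_kernel (real y) n)
      \<le> 1 - walk_symbol (real CARD('d)) (real CARD('d)) t y" for t
    unfolding real_norm_def abs_minus_commute[of "walk_kernel t y n"]
    by (rule poisson_kernel_diff_walk_kernel_le)
  from LIM_zero_cancel[OF Lim_null_comparison[OF always_eventually[OF allI[OF bound]] lim]] show ?thesis .
qed

section \<open>Order properties of the walk averages\<close>

lemma walk_average_nonneg:
  assumes "\<And>n. 0 \<le> f n"
  shows "0 \<le> walk_average f t y n"
proof (induction t arbitrary: y n)
  case 0
  then show ?case by (cases y) (auto simp: assms)
next
  case (Suc t)
  show ?case
  proof (cases y)
    case y: (Suc v)
    show ?thesis
      unfolding y walk_average.simps
      by (intro divide_nonneg_nonneg add_nonneg_nonneg sum_nonneg Suc.IH) auto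
  qed (simp add: assms)
qed

lemma walk_average_mono_time:
  assumes "\<And>n. 0 \<le> f n"
  shows "walk_average f t y (n :: int ^ 'd::finite) \<le> walk_average f (Suc t) y n"
proof (induction t arbitrary: y n)
  case 0
  then show ?case
    using walk_average_nonneg[of f "Suc 0" y n, OF assms] by (cases y) auto
next
  case (Suc t)
  show ?case
  proof (cases y)
    case y: (Suc v)
    have "walk_average f (Suc t) (Suc v) n = (walk_average f t (Suc (Suc v)) n + walk_average f t v n +
        (\<Sum>k\<in>UNIV. walk_average f t (Suc v) (n + axis k 1) + walk_average f t (Suc v) (n - axis k 1)))
        / (2 * (real CARD('d) + 1))"
      by (rule walk_average.simps)
    also have "\<dots> \<le> (walk_average f (Suc t) (Suc (Suc v)) n + walk_average f (Suc t) v n +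
        (\<Sum>k\<in>UNIV. walk_average f (Suc t) (Suc v) (n + axis k 1)
            + walk_average f (Suc t) (Suc v) (n - axis k 1)))
        / (2 * (real CARD('d) + 1))"
      by (intro divide_right_mono add_mono sum_mono Suc.IH) simp
    also have "\<dots> = walk_average f (Suc (Suc t)) (Suc v) n"
      by (rule walk_average.simps[symmetric])
    finally show ?thesis unfolding y .
  qed simp
qed

lemma walk_average_mono:
  assumes "\<And>n. f n \<le> g n"
  shows "walk_average f t y n \<le> walk_average g t y n"
proof (induction t arbitrary: y n)
  case 0
  then show ?case by (cases y) (auto simp: assms)
next
  case (Suc t)
  show ?case
  proof (cases y)
    case y: (Suc v)
    show ?thesis
      unfolding y walk_average.simps by (intro divide_right_mono add_mono sum_mono Suc.IH) simp
  qed (simp add: assms)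
qed

text \<open>For constant data all horizontal neighbours agree, and their sum becomes the term
  \<open>2 * d\<close> of the symbol at \<open>c = d\<close>.\<close>

lemma walk_average_const:
  "walk_average (\<lambda>_. c) t y (n :: int ^ 'd::finite)
      = c * walk_symbol (real CARD('d)) (real CARD('d)) t y"
proof (induction t arbitrary: y n)
  case 0
  then show ?case by (cases y) auto
next
  case (Suc t)
  then show ?case by (cases y) (auto simp: algebra_simps add_divide_distrib)
qed

text \<open>The total weight of a truncated average can be less than 1, hence the assumption
  \<open>0 \<le> C\<close>.\<close>

lemma walk_average_le_const:
  assumes "\<And>n. f n \<le> C" "0 \<le> C"
  shows "walk_average f t y (n :: int ^ 'd::finite) \<le> C"
proof -
  have "walk_average f t y n \<le> walk_average (\<lambda>_. C) t y n"
    by (intro walk_average_mono assms)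
  also have "\<dots> \<le> C * 1"
    unfolding walk_average_const using walk_symbol_diag_bounds[of "real CARD('d)" t y]
    by (intro mult_left_mono) (use assms in auto)
  finally show ?thesis by simp
qed

section \<open>Walk averages as convolutions and their limit\<close>

lemma has_sum_sum:
  fixes f :: "'i \<Rightarrow> 'a \<Rightarrow> 'b::topological_comm_monoid_add"
  assumes "\<And>i. i \<in> I \<Longrightarrow> (f i has_sum s i) A"
  shows "((\<lambda>x. \<Sum>i\<in>I. f i x) has_sum (\<Sum>i\<in>I. s i)) A"
  using assms by (induction I rule: infinite_finite_induct) (auto intro!: has_sum_add)

lemma bij_betw_translate: "bij_betw (\<lambda>n. n + a) UNIV (UNIV :: 'n::ab_group_add set)"
  by (rule bij_betwI[where g = "\<lambda>n. n - a"]) auto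

text \<open>Reindexing turns a shift of the kernel argument by \<open>a\<close> into the average at
  \<open>n + a\<close>, so both sides obey the same recursion. Using \<open>has_sum\<close> carries
  convergence along in the induction.\<close>

lemma walk_kernel_has_sum:
  "((\<lambda>m. f (n - m) * walk_kernel t y m) has_sum walk_average f t y n) UNIV"
proof (induction t arbitrary: y n)
  case 0
  have "((\<lambda>m. f (n - m) * of_bool (m = 0)) has_sum f n) UNIV" for n
    by (rule has_sum_finite_neutralI[where B = "{0}"]) auto
  then show ?case by (cases y) auto
next
  case (Suc t)
  show ?case
  proof (cases y)
    case 0
    have "((\<lambda>m. f (n - m) * of_bool (m = 0)) has_sum f n) UNIV" for n
      by (rule has_sum_finite_neutralI[where B = "{0}"]) auto
    then show ?thesis using 0 by simp
  next
    case y: (Suc v)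
    have shift: "((\<lambda>m. f (n - m) * walk_kernel t y (m + a))
        has_sum walk_average f t y (n + a)) UNIV" for y a
      using has_sum_reindex_bij_betw[OF bij_betw_translate[of a],
          of "\<lambda>m. f (n + a - m) * walk_kernel t y m"] Suc.IH[of "n + a" y]
      by (simp add: algebra_simps)
    have shift': "((\<lambda>m. f (n - m) * walk_kernel t y (m - a))
        has_sum walk_average f t y (n - a)) UNIV" for y a
      using shift[of y "- a"] by simp
    have "((\<lambda>m. (f (n - m) * walk_kernel t (Suc (Suc v)) m + f (n - m) * walk_kernel t v m +
        (\<Sum>k\<in>UNIV. f (n - m) * walk_kernel t (Suc v) (m + axis k 1)
            + f (n - m) * walk_kernel t (Suc v) (m - axis k 1)))
        * inverse (2 * (real CARD('a) + 1))) has_sum walk_average f (Suc t) y n) UNIV"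
      unfolding y walk_average.simps(3) divide_inverse
      by (intro has_sum_cmult_left has_sum_add has_sum_sum Suc.IH shift shift')
    then show ?thesis
      unfolding y walk_average.simps(3) divide_inverse
      by (simp only: sum_distrib_left distrib_left mult.assoc[symmetric])
  qed
qed

text \<open>The walk kernels increase to the Poisson kernel \<open>?K\<close>, so \<open>?K\<close>
  is nonnegative, and bounding finite sums in the limit gives it mass at most 1. The walk kernel has
  mass \<open>?m t\<close>, hence its \<open>l\<^sup>1\<close> distance to \<open>?K\<close> is at
  most \<open>1 - ?m t\<close>, which tends to 0.\<close>

lemma walk_average_tendsto_convolution:
  fixes f :: "int ^ 'd::finite \<Rightarrow> real"
  assumes f: "\<And>n. \<bar>f n\<bar> \<le> C"
  shows "(\<lambda>t. walk_average f t y n) \<longlonglongrightarrow> convolution f (poisson_kernel (real y)) n"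
proof -
  let ?K = "poisson_kernel (real y) :: int ^ 'd \<Rightarrow> real"
  let ?m = "\<lambda>t. walk_symbol (real CARD('d)) (real CARD('d)) t y"
  have walk_kernel_nonneg: "0 \<le> walk_kernel t y m" for t and m :: "int ^ 'd"
    by (rule walk_average_nonneg) simp
  have incseq: "incseq (\<lambda>t. walk_kernel t y m)" for m :: "int ^ 'd"
    by (intro incseq_SucI walk_average_mono_time) simp
  have le: "walk_kernel t y m \<le> ?K m" for t m
    by (rule incseq_le[OF incseq walk_kernel_tendsto_poisson_kernel])
  have mass: "(walk_kernel t y has_sum ?m t) (UNIV :: (int ^ 'd) set)" for t
    using walk_kernel_has_sum[of "\<lambda>_. 1" "0 :: int ^ 'd" t y] by (simp add: walk_average_const)
  have sum_le: "sum ?K F \<le> 1" if "finite F" for F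
  proof (rule LIMSEQ_le_const2)
    show "(\<lambda>t. \<Sum>m\<in>F. walk_kernel t y m) \<longlonglongrightarrow> sum ?K F"
      by (intro tendsto_sum walk_kernel_tendsto_poisson_kernel)
    have "(\<Sum>m\<in>F. walk_kernel t y m) \<le> ?m t" for t
      by (rule finite_sum_le_has_sum[OF mass]) (use that walk_kernel_nonneg in auto)
    also have "?m t \<le> 1" for t using walk_symbol_diag_bounds[of "real CARD('d)" t y] by simp
    finally show "\<exists>N. \<forall>t\<ge>N. (\<Sum>m\<in>F. walk_kernel t y m) \<le> 1" by blast
  qed
  have K_summable: "?K summable_on UNIV"
    using sum_le order_trans[OF walk_kernel_nonneg le[of 0]]
    by (intro nonneg_bdd_above_summable_on bdd_aboveI[where M = 1]) auto
  have K_le: "infsum ?K UNIV \<le> 1"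
    by (rule infsum_le_finite_sums[OF K_summable]) (use sum_le in auto)
  have C: "C \<ge> 0" using f[of 0] by simp
  have fK_summable: "(\<lambda>m. f (n - m) * ?K m) summable_on UNIV"
  proof (rule abs_summable_summable, rule summable_on_comparison_test)
    show "(\<lambda>m. C * ?K m) summable_on UNIV" by (rule summable_on_cmult_right[OF K_summable])
    show "norm (f (n - m) * ?K m) \<le> C * ?K m" for m
      using f order_trans[OF walk_kernel_nonneg le[of 0]] C by (auto simp: abs_mult intro: mult_mono)
  qed simp
  have bound': "norm (convolution f ?K n - walk_average f t y n) \<le> C * (1 - ?m t)" for t
  proof -
    have "((\<lambda>m. f (n - m) * ?K m + - (f (n - m) * walk_kernel t y m))
        has_sum (convolution f ?K n + - walk_average f t y n)) UNIV"
      unfolding convolution_def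
      by (intro has_sum_add has_sum_infsum fK_summable has_sum_uminusI walk_kernel_has_sum)
    moreover have "((\<lambda>m. C * (?K m + - walk_kernel t y m)) has_sum C * (infsum ?K UNIV + - ?m t)) UNIV"
      by (intro has_sum_cmult_right has_sum_add has_sum_infsum K_summable has_sum_uminusI mass)
    moreover have "norm (f (n - m) * ?K m + - (f (n - m) * walk_kernel t y m))
        \<le> C * (?K m + - walk_kernel t y m)" for m
    proof -
      have "norm (f (n - m) * ?K m + - (f (n - m) * walk_kernel t y m))
          = \<bar>f (n - m)\<bar> * (?K m - walk_kernel t y m)"
        using le[of t m] by (simp add: right_diff_distrib[symmetric] abs_mult)
      also have "\<dots> \<le> C * (?K m - walk_kernel t y m)"
        using le[of t m] f by (intro mult_right_mono) auto
      finally show ?thesis by simp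
    qed
    ultimately have "norm (convolution f ?K n + - walk_average f t y n) \<le> C * (infsum ?K UNIV + - ?m t)"
      by (rule norm_infsum_le)
    also have "\<dots> \<le> C * (1 - ?m t)"
      using C K_le by (intro mult_left_mono) auto
    finally show ?thesis by simp
  qed
  have lim: "(\<lambda>t. C * (1 - ?m t)) \<longlonglongrightarrow> 0"
    using tendsto_mult[OF tendsto_const tendsto_diff[OF tendsto_const
        walk_symbol_diag_tendsto_1[of "real CARD('d)" y]], of C 1]
    by (simp only: of_nat_0_le_iff diff_self simp_thms mult_zero_right)
  have bound: "norm (walk_average f t y n - convolution f ?K n) \<le> C * (1 - ?m t)" for t
    using bound'[of t] unfolding real_norm_def abs_minus_commute[of "walk_average f t y n"] .
  from LIM_zero_cancel[OF Lim_null_comparison[OF always_eventually[OF allI[OF bound]] lim]] show ?thesis .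
qed

subsection \<open>Summation by parts and convexity\<close>

definition lp_summable :: "real \<Rightarrow> ('n \<Rightarrow> real) \<Rightarrow> bool" where
  "lp_summable p g \<longleftrightarrow> (\<lambda>n. \<bar>g n\<bar> powr p) summable_on UNIV"

text \<open>Both terms are at most \<open>m\<close>, and \<open>m powr p\<close> is one of the two
  summands on the right. The crude constant suffices for questions of summability.\<close>

lemma abs_add_powr_le:
  fixes a b p :: real
  assumes "0 \<le> p"
  shows "\<bar>a + b\<bar> powr p \<le> 2 powr p * (\<bar>a\<bar> powr p + \<bar>b\<bar> powr p)"
proof -
  define m where "m = max \<bar>a\<bar> \<bar>b\<bar>"
  have "\<bar>a + b\<bar> powr p \<le> (2 * m) powr p"
    using assms by (intro powr_mono2) (auto simp: m_def)
  also have "\<dots> = 2 powr p * m powr p"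
    by (simp add: powr_mult m_def)
  also have "\<dots> \<le> 2 powr p * (\<bar>a\<bar> powr p + \<bar>b\<bar> powr p)"
    by (intro mult_left_mono) (auto simp: m_def max_def)
  finally show ?thesis .
qed

lemma lp_summable_mono:
  assumes "lp_summable p g" "0 \<le> p" "\<And>n. \<bar>f n\<bar> \<le> \<bar>g n\<bar>"
  shows "lp_summable p f"
  using assms(1) unfolding lp_summable_def
  by (rule summable_on_comparison_test) (use assms in \<open>auto intro: powr_mono2\<close>)

lemma lp_summable_add:
  assumes "lp_summable p f" "lp_summable p g" "0 \<le> p"
  shows "lp_summable p (\<lambda>n. f n + g n)"
proof -
  have "(\<lambda>n. 2 powr p * (\<bar>f n\<bar> powr p + \<bar>g n\<bar> powr p)) summable_on UNIV"
    using assms unfolding lp_summable_def by (intro summable_on_cmult_right summable_on_add)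
  then show ?thesis
    unfolding lp_summable_def
    by (rule summable_on_comparison_test) (auto simp: abs_add_powr_le assms)
qed

lemma lp_summable_sum:
  assumes "\<And>i. i \<in> I \<Longrightarrow> lp_summable p (g i)" "0 \<le> p"
  shows "lp_summable p (\<lambda>n. \<Sum>i\<in>I. g i n)"
  using assms(1)
proof (induction I rule: infinite_finite_induct)
  case (insert i I)
  then have "lp_summable p (g i)" "lp_summable p (\<lambda>n. \<Sum>j\<in>I. g j n)" by auto
  from lp_summable_add[OF this assms(2)] insert(1,2) show ?case by simp
qed (auto simp: lp_summable_def)

lemma summable_on_translate:
  fixes a :: "'n::ab_group_add"
  shows "(\<lambda>n. g (n + a)) summable_on UNIV \<longleftrightarrow> g summable_on UNIV"
  by (rule summable_on_reindex_bij_betw[OF bij_betw_translate])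

lemma lp_summable_translate:
  "lp_summable p g \<Longrightarrow> lp_summable p (\<lambda>n. g (n + a))" for a :: "'n::ab_group_add"
  unfolding lp_summable_def by (subst summable_on_translate[of "\<lambda>n. \<bar>g n\<bar> powr p"])

text \<open>A subgradient of \<open>\<lambda>x. \<bar>x\<bar> powr p\<close>; at the kink \<open>x = 0\<close> for \<open>p = 1\<close> it selects \<open>0\<close>.\<close>
definition abs_powr_deriv :: "real \<Rightarrow> real \<Rightarrow> real" where
  "abs_powr_deriv p x = p * sgn x * \<bar>x\<bar> powr (p - 1)"

text \<open>For nonzero \<open>t\<close>, dropping the sign of \<open>s\<close> reduces the claim to
  Young's inequality with weights \<open>(p - 1) / p\<close> and \<open>1 / p\<close>, applied to
  \<open>\<bar>t\<bar> powr p\<close> and \<open>\<bar>s\<bar> powr p\<close>.\<close>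

lemma abs_powr_tangent:
  assumes "1 \<le> p"
  shows "\<bar>t\<bar> powr p + abs_powr_deriv p t * (s - t) \<le> \<bar>s\<bar> powr p"
proof (cases "t = 0")
  case True
  then show ?thesis by (simp add: abs_powr_deriv_def)
next
  case False
  define a b where "a = \<bar>t\<bar>" and "b = \<bar>s\<bar>"
  have a: "a > 0" and b: "b \<ge> 0" using False by (auto simp: a_def b_def)
  have "a powr (p - 1) * a = a powr p"
    using powr_mult_base[of a "p - 1"] a by (simp add: mult.commute)
  moreover have "sgn t * t = a" by (simp add: a_def sgn_if)
  moreover have "abs_powr_deriv p t * t = p * (a powr (p - 1) * (sgn t * t))"
    by (simp add: abs_powr_deriv_def a_def mult_ac)
  ultimately have t: "abs_powr_deriv p t * t = p * a powr p" by simp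
  have "p * a powr (p - 1) * (sgn t * s) \<le> p * a powr (p - 1) * b"
    using assms by (intro mult_left_mono) (auto simp: b_def sgn_if)
  then have s: "abs_powr_deriv p t * s \<le> p * (a powr (p - 1) * b)"
    by (simp add: abs_powr_deriv_def a_def mult_ac)
  have "p * (a powr (p - 1) * b) \<le> (p - 1) * a powr p + b powr p"
  proof (cases "b = 0")
    case False
    have "(a powr p) powr ((p - 1) / p) * (b powr p) powr (1 / p)
        \<le> (p - 1) / p * a powr p + 1 / p * b powr p"
      using assms a b False by (intro Youngs_inequality_0) (auto simp: field_simps)
    then have "a powr (p - 1) * b \<le> (p - 1) / p * a powr p + 1 / p * b powr p"
      using assms a b False by (simp add: powr_powr)
    also have "\<dots> = ((p - 1) * a powr p + b powr p) / p"
      by (simp add: add_divide_distrib)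
    finally show ?thesis
      using assms by (simp add: pos_le_divide_eq mult.commute)
  qed (use assms in simp)
  with s t show ?thesis by (simp add: right_diff_distrib left_diff_distrib a_def b_def)
qed

lemma abs_powr_deriv_mono:
  assumes "1 \<le> p" "x \<le> y"
  shows "abs_powr_deriv p x \<le> abs_powr_deriv p y"
proof -
  consider "0 \<le> x" | "y \<le> 0" | "x < 0" "0 < y" by linarith
  then show ?thesis
  proof cases
    case 1
    then have "\<bar>x\<bar> powr (p - 1) \<le> \<bar>y\<bar> powr (p - 1)" using assms by (intro powr_mono2) auto
    then show ?thesis using 1 assms by (auto simp: abs_powr_deriv_def sgn_if)
  next
    case 2
    then have "\<bar>y\<bar> powr (p - 1) \<le> \<bar>x\<bar> powr (p - 1)" using assms by (intro powr_mono2) auto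
    then show ?thesis using 2 assms by (auto simp: abs_powr_deriv_def sgn_if)
  next
    case 3
    then have "abs_powr_deriv p x \<le> 0" "0 \<le> abs_powr_deriv p y"
      using assms by (auto simp: abs_powr_deriv_def)
    then show ?thesis by linarith
  qed
qed

text \<open>A pointwise substitute for Hoelder's inequality, obtained by replacing both factors with
  the larger absolute value \<open>m\<close>.\<close>

lemma abs_powr_deriv_mult_le:
  assumes "1 \<le> p"
  shows "\<bar>abs_powr_deriv p a * b\<bar> \<le> p * (\<bar>a\<bar> powr p + \<bar>b\<bar> powr p)"
proof -
  define m where "m = max \<bar>a\<bar> \<bar>b\<bar>"
  have "\<bar>abs_powr_deriv p a * b\<bar> \<le> p * (\<bar>a\<bar> powr (p - 1) * \<bar>b\<bar>)"
    using assms by (auto simp: abs_powr_deriv_def abs_mult sgn_if)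
  also have "\<bar>a\<bar> powr (p - 1) * \<bar>b\<bar> \<le> m powr (p - 1) * m"
    using assms by (intro mult_mono powr_mono2) (auto simp: m_def)
  also have "m powr (p - 1) * m = m powr p"
    using powr_mult_base[of m "p - 1"] by (simp add: m_def mult.commute)
  also have "m powr p \<le> \<bar>a\<bar> powr p + \<bar>b\<bar> powr p"
    by (auto simp: m_def max_def)
  finally show ?thesis using assms by simp
qed

lemma lp_summable_deriv_mult:
  assumes "1 \<le> p" "lp_summable p g" "lp_summable p h"
  shows "(\<lambda>n. abs_powr_deriv p (g n) * h n) summable_on UNIV"
proof -
  have "(\<lambda>n. p * (\<bar>g n\<bar> powr p + \<bar>h n\<bar> powr p)) summable_on UNIV"
    using assms unfolding lp_summable_def by (intro summable_on_cmult_right summable_on_add)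
  then have "(\<lambda>n. norm (abs_powr_deriv p (g n) * h n)) summable_on UNIV"
    by (rule summable_on_comparison_test)
      (simp_all only: real_norm_def abs_powr_deriv_mult_le assms abs_ge_zero)
  then show ?thesis by (rule abs_summable_summable)
qed

lemma lp_summable_partial_diff:
  assumes "lp_summable p w" "0 \<le> p"
  shows "lp_summable p (partial_diff i w)"
proof -
  have "lp_summable p (\<lambda>n. - w n)" using assms(1) by (simp add: lp_summable_def)
  from lp_summable_add[OF lp_summable_translate[OF assms(1), of "axis i 1"] this assms(2)]
  show ?thesis by (simp add: partial_diff_def[abs_def])
qed

text \<open>Summation by parts turns the first-order term of the tangent inequality into
  \<open>w\<close> times the \<open>p\<close>-Laplacian of \<open>M\<close>.\<close>
lemma energy_le_of_subharmonic:
  fixes f M :: "int ^ 'd::finite \<Rightarrow> real"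
  assumes p: "1 \<le> p"
    and M_ge: "\<And>n. f n \<le> M n"
    and w: "lp_summable p (\<lambda>n. M n - f n)"
    and f: "\<And>i. lp_summable p (partial_diff i f)"
    and subharmonic: "\<And>n. f n < M n \<Longrightarrow>
      0 \<le> (\<Sum>i\<in>UNIV. abs_powr_deriv p (partial_diff i M n)
          - abs_powr_deriv p (partial_diff i M (n - axis i 1)))"
  shows "(\<lambda>n. \<Sum>i\<in>UNIV. \<bar>partial_diff i M n\<bar> powr p) summable_on UNIV"
    and "(\<Sum>\<^sub>\<infinity>n. \<Sum>i\<in>UNIV. \<bar>partial_diff i M n\<bar> powr p) \<le> (\<Sum>\<^sub>\<infinity>n. \<Sum>i\<in>UNIV. \<bar>partial_diff i f n\<bar> powr p)"
proof -
  define w where "w n = M n - f n" for n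
  have w_summable: "lp_summable p w" using assms(3) by (simp add: w_def[abs_def])
  have w_nonneg: "0 \<le> w n" for n using M_ge by (simp add: w_def)
  have diff_M: "partial_diff i M n = partial_diff i f n + partial_diff i w n" for i n
    by (simp add: partial_diff_def w_def)
  have M_summable: "lp_summable p (partial_diff i M)" for i
    using lp_summable_add[OF f[of i] lp_summable_partial_diff[OF w_summable, of i]] p
    by (simp add: diff_M[symmetric])
  define a where "a i n = abs_powr_deriv p (partial_diff i M n)" for i n
  \<comment> \<open>Convergence of these series, from \<open>w\<close> being in
    \<open>l\<^sup>p\<close>, is what makes the summation by parts free of boundary terms.\<close>
  have summable_a: "(\<lambda>n. a i n * w n) summable_on UNIV"
      "(\<lambda>n. a i n * w (n + axis i 1)) summable_on UNIV" for i
    unfolding a_def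
    by (intro lp_summable_deriv_mult p M_summable w_summable lp_summable_translate)+
  define X Y A B where "X = (\<Sum>i\<in>UNIV. \<Sum>\<^sub>\<infinity>n. a i n * w (n + axis i 1))"
    and "Y = (\<Sum>i\<in>UNIV. \<Sum>\<^sub>\<infinity>n. a i n * w n)"
    and "A = (\<Sum>i\<in>UNIV. \<Sum>\<^sub>\<infinity>n. \<bar>partial_diff i M n\<bar> powr p)"
    and "B = (\<Sum>i\<in>UNIV. \<Sum>\<^sub>\<infinity>n. \<bar>partial_diff i f n\<bar> powr p)"
  have A: "((\<lambda>n. \<Sum>i\<in>UNIV. \<bar>partial_diff i M n\<bar> powr p) has_sum A) UNIV"
    unfolding A_def using M_summable by (intro has_sum_sum has_sum_infsum) (auto simp: lp_summable_def)
  have B: "((\<lambda>n. \<Sum>i\<in>UNIV. \<bar>partial_diff i f n\<bar> powr p) has_sum B) UNIV"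
    unfolding B_def using f by (intro has_sum_sum has_sum_infsum) (auto simp: lp_summable_def)
  have X: "((\<lambda>n. \<Sum>i\<in>UNIV. a i n * w (n + axis i 1)) has_sum X) UNIV"
    unfolding X_def by (intro has_sum_sum has_sum_infsum summable_a)
  have Y: "((\<lambda>n. \<Sum>i\<in>UNIV. a i n * w n) has_sum Y) UNIV"
    unfolding Y_def by (intro has_sum_sum has_sum_infsum summable_a)
  \<comment> \<open>Index shift moving the difference from \<open>w\<close> to
    \<open>a\<close>.\<close>
  have "((\<lambda>n. a i (n - axis i 1) * w n) has_sum (\<Sum>\<^sub>\<infinity>n. a i n * w (n + axis i 1))) UNIV" for i
    using has_sum_infsum[OF summable_a(2)[of i]]
      has_sum_reindex_bij_betw[OF bij_betw_translate[of "axis i 1"], of "\<lambda>n. a i (n - axis i 1) * w n"]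
    by simp
  then have X': "((\<lambda>n. \<Sum>i\<in>UNIV. a i (n - axis i 1) * w n) has_sum X) UNIV"
    unfolding X_def by (intro has_sum_sum)
  \<comment> \<open>Tangent inequality at the slope of \<open>M\<close>, evaluated at the slope of
    \<open>f\<close>. The linear terms are kept on the side where no subtraction of series is
    required.\<close>
  have "A + Y \<le> B + X"
  proof (rule has_sum_mono[OF has_sum_add[OF A Y] has_sum_add[OF B X]])
    fix n
    have "\<bar>partial_diff i M n\<bar> powr p + a i n * w n
        \<le> \<bar>partial_diff i f n\<bar> powr p + a i n * w (n + axis i 1)" for i
    proof -
      have "\<bar>partial_diff i M n\<bar> powr p + a i n * (partial_diff i f n - partial_diff i M n)
          \<le> \<bar>partial_diff i f n\<bar> powr p"
        unfolding a_def by (rule abs_powr_tangent[OF p])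
      moreover have "partial_diff i f n - partial_diff i M n = w n - w (n + axis i 1)"
        by (simp add: partial_diff_def w_def)
      ultimately show ?thesis by (simp add: algebra_simps)
    qed
    then show "(\<Sum>i\<in>UNIV. \<bar>partial_diff i M n\<bar> powr p) + (\<Sum>i\<in>UNIV. a i n * w n)
        \<le> (\<Sum>i\<in>UNIV. \<bar>partial_diff i f n\<bar> powr p) + (\<Sum>i\<in>UNIV. a i n * w (n + axis i 1))"
      unfolding sum.distrib[symmetric] by (rule sum_mono)
  qed
  \<comment> \<open>Termwise: either \<open>w n\<close> vanishes, or \<open>M\<close> exceeds
    \<open>f\<close> at \<open>n\<close> and \<open>subharmonic\<close> gives the sign.\<close>
  moreover have "X \<le> Y"
  proof (rule has_sum_mono[OF X' Y])
    fix n
    have "0 \<le> (\<Sum>i\<in>UNIV. a i n - a i (n - axis i 1)) * w n"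
    proof (cases "w n = 0")
      case False
      then have "f n < M n" using w_nonneg[of n] by (simp add: w_def)
      from subharmonic[OF this] w_nonneg[of n] show ?thesis
        unfolding a_def by (rule mult_nonneg_nonneg)
    qed simp
    then show "(\<Sum>i\<in>UNIV. a i (n - axis i 1) * w n) \<le> (\<Sum>i\<in>UNIV. a i n * w n)"
      by (simp add: sum_subtractf left_diff_distrib sum_distrib_right)
  qed
  ultimately have "A \<le> B" by linarith
  then show "(\<Sum>\<^sub>\<infinity>n. \<Sum>i\<in>UNIV. \<bar>partial_diff i M n\<bar> powr p) \<le> (\<Sum>\<^sub>\<infinity>n. \<Sum>i\<in>UNIV. \<bar>partial_diff i f n\<bar> powr p)"
    using infsumI[OF A] infsumI[OF B] by simp
  show "(\<lambda>n. \<Sum>i\<in>UNIV. \<bar>partial_diff i M n\<bar> powr p) summable_on UNIV"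
    using A by (rule has_sum_imp_summable)
qed

subsection \<open>The truncated maximal function\<close>

definition walk_max :: "(int ^ 'd::finite \<Rightarrow> real) \<Rightarrow> nat \<Rightarrow> int ^ 'd \<Rightarrow> real" where
  "walk_max f t n = (SUP y. walk_average f t y n)"

text \<open>One step of the walk in dimension d + 1 for a function independent of height:
  \<open>2 * g n\<close> stands for the two vertical neighbours.\<close>

definition neighbor_average :: "(int ^ 'd::finite \<Rightarrow> real) \<Rightarrow> int ^ 'd \<Rightarrow> real" where
  "neighbor_average g n =
    (2 * g n + (\<Sum>k\<in>UNIV. g (n + axis k 1) + g (n - axis k 1))) / (2 * (real CARD('d) + 1))"

lemma neighbor_average_mono: "(\<And>n. g n \<le> h n) \<Longrightarrow> neighbor_average g n \<le> neighbor_average h n"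
  unfolding neighbor_average_def by (intro divide_right_mono add_mono mult_left_mono sum_mono) auto

context
  fixes f :: "int ^ 'd::finite \<Rightarrow> real" and C :: real
  assumes f_nonneg: "\<And>n. 0 \<le> f n" and f_le: "\<And>n. f n \<le> C"
begin

lemma C_nonneg: "0 \<le> C"
  using order_trans[OF f_nonneg f_le] .

lemma bdd_above_walk_average: "bdd_above (range (\<lambda>y. walk_average f t y n))"
  using walk_average_le_const[OF f_le C_nonneg] by (intro bdd_aboveI2)

lemma walk_average_le_walk_max: "walk_average f t y n \<le> walk_max f t n"
  unfolding walk_max_def by (rule cSUP_upper[OF UNIV_I bdd_above_walk_average])

lemma le_walk_max: "f n \<le> walk_max f t n"
  using walk_average_le_walk_max[of t 0 n] by simp

lemma walk_max_mono_time: "walk_max f t n \<le> walk_max f (Suc t) n"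
  unfolding walk_max_def[of f t]
  by (intro cSUP_least) (auto simp del: walk_average.simps
      intro: order_trans[OF walk_average_mono_time[OF f_nonneg] walk_average_le_walk_max])

lemma walk_max_0: "walk_max f 0 n = f n"
proof (rule antisym)
  show "walk_max f 0 n \<le> f n"
    unfolding walk_max_def
  proof (rule cSUP_least)
    show "walk_average f 0 y n \<le> f n" for y
      using f_nonneg by (cases y) auto
  qed simp
qed (rule le_walk_max)

text \<open>Height 0 contributes \<open>f n\<close>; at positive height each term of the recursion
  is bounded by the maximal function at its own site.\<close>

lemma walk_max_Suc_le: "walk_max f (Suc t) n \<le> max (f n) (neighbor_average (walk_max f t) n)"
  unfolding walk_max_def[of f "Suc t"]
proof (rule cSUP_least)
  fix y
  show "walk_average f (Suc t) y n \<le> max (f n) (neighbor_average (walk_max f t) n)"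
  proof (cases y)
    case y: (Suc v)
    have "walk_average f (Suc t) (Suc v) n \<le> (walk_max f t n + walk_max f t n +
        (\<Sum>k\<in>UNIV. walk_max f t (n + axis k 1) + walk_max f t (n - axis k 1)))
        / (2 * (real CARD('d) + 1))"
      unfolding walk_average.simps
      by (intro divide_right_mono add_mono sum_mono walk_average_le_walk_max) simp
    also have "\<dots> = neighbor_average (walk_max f t) n"
      by (simp add: neighbor_average_def)
    finally show ?thesis using y by simp
  qed simp
qed simp

text \<open>Above \<open>f\<close>, \<open>walk_max_Suc_le\<close> must bound by the neighbour
  average at the previous time, and monotonicity in time raises that to the present time. The two
  vertical copies of \<open>?M n\<close> then cancel, leaving the Laplacian in dimension d. At time
  0 the assumption is contradictory.\<close>

lemma walk_max_subharmonic:
  assumes "f n < walk_max f t n"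
  shows "0 \<le> (\<Sum>i\<in>UNIV. partial_diff i (walk_max f t) n - partial_diff i (walk_max f t) (n - axis i 1))"
proof (cases t)
  case 0
  then show ?thesis using assms walk_max_0 by simp
next
  case (Suc s)
  let ?M = "walk_max f t"
  have "?M n \<le> neighbor_average (walk_max f s) n"
    using walk_max_Suc_le[of s n] assms Suc by (auto simp: max_def split: if_splits)
  also have "\<dots> \<le> neighbor_average ?M n"
    unfolding Suc by (intro neighbor_average_mono walk_max_mono_time)
  finally have "2 * real CARD('d) * ?M n \<le> (\<Sum>k\<in>UNIV. ?M (n + axis k 1) + ?M (n - axis k 1))"
    unfolding neighbor_average_def by (simp add: pos_le_divide_eq) (simp add: algebra_simps)
  also have "\<dots> = (\<Sum>i\<in>UNIV. partial_diff i ?M n - partial_diff i ?M (n - axis i 1))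
      + 2 * real CARD('d) * ?M n"
    by (simp add: partial_diff_def sum.distrib sum_subtractf)
  finally show ?thesis by linarith
qed

text \<open>Each time step bounds the new difference by finitely many translates of the old one and
  of the partial differences of \<open>f\<close>. The bound may grow with \<open>t\<close>; only
  finiteness for each fixed \<open>t\<close> matters.\<close>

lemma lp_summable_walk_max_diff:
  assumes p: "0 \<le> p" and f': "\<And>i. lp_summable p (partial_diff i f)"
  shows "lp_summable p (\<lambda>n. walk_max f t n - f n)"
proof (induction t)
  case 0
  then show ?case by (simp add: walk_max_0 lp_summable_def)
next
  case (Suc t)
  define w where "w n = walk_max f t n - f n" for n
  have w_nonneg: "0 \<le> w n" for n using le_walk_max[of n t] by (simp add: w_def)
  have w: "lp_summable p w" using Suc by (simp add: w_def[abs_def])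
  \<comment> \<open>A majorant for the two neighbour values in direction \<open>k\<close> minus
    \<open>2 * f n\<close>: the excess \<open>w\<close> at each neighbour plus the slope of
    \<open>f\<close> towards it.\<close>
  define v where "v = (\<lambda>k n. (w (n + axis k 1) + w (n + - axis k 1)) +
    (\<bar>partial_diff k f n\<bar> + \<bar>partial_diff k f (n + - axis k 1)\<bar>))"
  have abs_f': "lp_summable p (\<lambda>n. \<bar>partial_diff i f n\<bar>)" for i
    using f'[of i] by (simp add: lp_summable_def)
  have "lp_summable p (\<lambda>n. w n + (\<Sum>k\<in>UNIV. v k n))"
    unfolding v_def
    by (intro lp_summable_add lp_summable_sum p w lp_summable_translate[OF w] abs_f'
        lp_summable_translate[OF abs_f'])
  then show ?case
  proof (rule lp_summable_mono[OF _ p])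
    fix n
    have v_nonneg: "0 \<le> v k n" for k
      using w_nonneg by (simp add: v_def)
    have rhs_nonneg: "0 \<le> w n + (\<Sum>k\<in>UNIV. v k n)"
      using w_nonneg[of n] v_nonneg by (intro add_nonneg_nonneg sum_nonneg)
    have "walk_max f t (n + axis k 1) + walk_max f t (n - axis k 1) \<le> v k n + 2 * f n" for k
      by (simp add: v_def w_def partial_diff_def)
    then have "(\<Sum>k\<in>UNIV. walk_max f t (n + axis k 1) + walk_max f t (n - axis k 1))
        \<le> (\<Sum>k\<in>UNIV. v k n + 2 * f n)"
      by (intro sum_mono)
    also have "\<dots> = (\<Sum>k\<in>UNIV. v k n) + 2 * real CARD('d) * f n"
      by (simp add: sum.distrib)
    finally have "neighbor_average (walk_max f t) n \<le>
        (2 * (w n + f n) + ((\<Sum>k\<in>UNIV. v k n) + 2 * real CARD('d) * f n)) / (2 * (real CARD('d) + 1))"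
      unfolding neighbor_average_def by (intro divide_right_mono) (auto simp: w_def)
    also have "\<dots> = f n + (2 * w n + (\<Sum>k\<in>UNIV. v k n)) / (2 * (real CARD('d) + 1))"
      by (simp add: field_simps)
    also have "(2 * w n + (\<Sum>k\<in>UNIV. v k n)) / (2 * (real CARD('d) + 1)) \<le> w n + (\<Sum>k\<in>UNIV. v k n)"
    proof -
      have "2 * w n + (\<Sum>k\<in>UNIV. v k n) \<le> 2 * (w n + (\<Sum>k\<in>UNIV. v k n))"
        using v_nonneg by (simp add: sum_nonneg)
      also have "\<dots> \<le> (2 * (real CARD('d) + 1)) * (w n + (\<Sum>k\<in>UNIV. v k n))"
        using rhs_nonneg by (intro mult_right_mono) auto
      finally show ?thesis by (simp add: pos_divide_le_eq mult.commute)
    qed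
    finally have "neighbor_average (walk_max f t) n \<le> f n + (w n + (\<Sum>k\<in>UNIV. v k n))" by simp
    then have "walk_max f (Suc t) n - f n \<le> w n + (\<Sum>k\<in>UNIV. v k n)"
      using walk_max_Suc_le[of t n] rhs_nonneg by linarith
    then show "\<bar>walk_max f (Suc t) n - f n\<bar> \<le> \<bar>w n + (\<Sum>k\<in>UNIV. v k n)\<bar>"
      using le_walk_max[of n "Suc t"] rhs_nonneg by simp
  qed
qed

text \<open>Exchange of a supremum over heights with an increasing limit: a nearly optimal height
  gives the lower bound, and every walk average lies below its limit.\<close>

lemma walk_max_tendsto:
  "(\<lambda>t. walk_max f t n) \<longlonglongrightarrow> (SUP y. convolution f (poisson_kernel (real y)) n)"
proof -
  let ?u = "\<lambda>y. convolution f (poisson_kernel (real y)) n"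
  have f_abs: "\<bar>f n\<bar> \<le> C" for n
    using f_nonneg f_le by simp
  have lim: "(\<lambda>t. walk_average f t y n) \<longlonglongrightarrow> ?u y" for y
    by (rule walk_average_tendsto_convolution[OF f_abs])
  have walk_le: "walk_average f t y n \<le> ?u y" for t y
    by (intro incseq_le[OF incseq_SucI lim] walk_average_mono_time f_nonneg)
  have "?u y \<le> C" for y
    by (intro LIMSEQ_le_const2[OF lim] exI allI impI walk_average_le_const f_le C_nonneg)
  then have bdd: "bdd_above (range ?u)"
    by (intro bdd_aboveI2)
  show ?thesis
  proof (rule order_tendstoI)
    fix a assume "a < (SUP y. ?u y)"
    then obtain y where "a < ?u y"
      using less_cSUP_iff[OF _ bdd] by auto
    then have "\<forall>\<^sub>F t in sequentially. a < walk_average f t y n"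
      by (rule order_tendstoD(1)[OF lim])
    then show "\<forall>\<^sub>F t in sequentially. a < walk_max f t n"
      by eventually_elim (rule less_le_trans[OF _ walk_average_le_walk_max])
  next
    fix a assume a: "(SUP y. ?u y) < a"
    have "walk_max f t n \<le> (SUP y. ?u y)" for t
      unfolding walk_max_def by (intro cSUP_mono bdd) (auto intro: walk_le)
    with a show "\<forall>\<^sub>F t in sequentially. walk_max f t n < a"
      by (intro always_eventually allI) (rule le_less_trans)
  qed
qed

text \<open>The weights of one step add up to 1, so a common error \<open>L\<close> is preserved;
  \<open>0 \<le> L\<close> covers the value 0 at time 0 and positive height.\<close>

lemma walk_average_lipschitz:
  assumes "\<And>n. f (n + a) \<le> f n + L" "0 \<le> L"
  shows "walk_average f t y (n + a) \<le> walk_average f t y n + L"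
proof (induction t arbitrary: y n)
  case 0
  then show ?case by (cases y) (auto simp: assms)
next
  case (Suc t)
  show ?case
  proof (cases y)
    case y: (Suc v)
    have shift: "n + a + b = (n + b) + a" "n + a - b = (n - b) + a" for b by simp_all
    have "walk_average f (Suc t) (Suc v) (n + a)
        \<le> ((walk_average f t (Suc (Suc v)) n + L) + (walk_average f t v n + L) +
        (\<Sum>k\<in>UNIV. (walk_average f t (Suc v) (n + axis k 1) + L)
            + (walk_average f t (Suc v) (n - axis k 1) + L)))
        / (2 * (real CARD('d) + 1))"
      unfolding walk_average.simps shift
      by (intro divide_right_mono add_mono[of _ _ "sum _ _"] add_mono[of "walk_average _ _ _ _"]
          sum_mono Suc.IH) simp
    also have "\<dots> = walk_average f (Suc t) (Suc v) n + L"
      by (simp add: sum.distrib field_simps)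
    finally show ?thesis unfolding y .
  qed (simp add: assms)
qed

lemma walk_max_lipschitz:
  assumes "\<And>n. f (n + a) \<le> f n + L" "0 \<le> L"
  shows "walk_max f t (n + a) \<le> walk_max f t n + L"
  unfolding walk_max_def[of f t "n + a"]
proof (rule cSUP_least)
  show "walk_average f t y (n + a) \<le> walk_max f t n + L" for y
    using walk_average_lipschitz[OF assms, of t y n] walk_average_le_walk_max[of t y n] by simp
qed simp

end

subsection \<open>The Poisson maximal function\<close>

text \<open>Here the restriction on \<open>p\<close> and the dimension enters: for
  \<open>p = 2\<close> the derivative is linear and commutes with the sum, while in dimension 1
  there is a single difference and monotonicity suffices.\<close>

lemma abs_powr_deriv_sum_nonneg:
  fixes a b :: "'d::finite \<Rightarrow> real"
  assumes p: "1 \<le> p" "p = 2 \<or> CARD('d) = 1"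
    and sum: "0 \<le> (\<Sum>i\<in>UNIV. a i - b i)"
  shows "0 \<le> (\<Sum>i\<in>UNIV. abs_powr_deriv p (a i) - abs_powr_deriv p (b i))"
  using p(2)
proof
  assume "p = 2"
  then have "abs_powr_deriv p x = 2 * x" for x
    by (simp add: abs_powr_deriv_def sgn_mult_abs)
  then have "(\<Sum>i\<in>UNIV. abs_powr_deriv p (a i) - abs_powr_deriv p (b i)) = 2 * (\<Sum>i\<in>UNIV. a i - b i)"
    by (simp add: sum_distrib_left algebra_simps)
  then show ?thesis using sum by simp
next
  assume "CARD('d) = 1"
  then obtain i where i: "(UNIV :: 'd set) = {i}" by (auto simp: card_1_singleton_iff)
  show ?thesis
    using sum abs_powr_deriv_mono[OF p(1), of "b i" "a i"] unfolding i by simp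
qed

lemma walk_max_tendsto_poisson_max:
  assumes "\<And>n. \<bar>u n\<bar> \<le> C"
  shows "(\<lambda>t. walk_max (\<lambda>m. \<bar>u m\<bar>) t n) \<longlonglongrightarrow> poisson_max u n"
  unfolding poisson_max_def by (rule walk_max_tendsto) (use assms in auto)

lemma partial_diff_poisson_max_bound:
  assumes bdd: "bounded (range u)" and L: "\<And>n. \<bar>partial_diff i u n\<bar> \<le> L"
  shows "\<bar>partial_diff i (poisson_max u) n\<bar> \<le> L"
proof -
  obtain C where C: "\<And>n. \<bar>u n\<bar> \<le> C"
    using bdd by (auto simp: bounded_iff)
  let ?f = "\<lambda>m. \<bar>u m\<bar>"
  have L_nonneg: "0 \<le> L" using order_trans[OF abs_ge_zero L] .
  \<comment> \<open>One-sided for an arbitrary shift; the shifts \<open>axis i 1\<close> and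
    \<open>- axis i 1\<close> give the two halves of the absolute value.\<close>
  have lip: "poisson_max u (m + a) \<le> poisson_max u m + L" if a: "\<And>n. ?f (n + a) \<le> ?f n + L" for m a
  proof (rule LIMSEQ_le[OF walk_max_tendsto_poisson_max[OF C]
      tendsto_add[OF walk_max_tendsto_poisson_max[OF C] tendsto_const]])
    show "\<exists>N. \<forall>t\<ge>N. walk_max ?f t (m + a) \<le> walk_max ?f t m + L"
      by (intro exI allI impI walk_max_lipschitz[OF abs_ge_zero C] a L_nonneg)
  qed
  have "?f (n + axis i 1) \<le> ?f n + L" for n
    using L[of n] by (simp add: partial_diff_def)
  moreover have "?f (n + - axis i 1) \<le> ?f n + L" for n
    using L[of "n - axis i 1"] by (simp add: partial_diff_def)
  ultimately show ?thesis
    using lip[of "axis i 1" n] lip[of "- axis i 1" "n + axis i 1"]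
    by (simp add: partial_diff_def abs_le_iff)
qed

text \<open>A Fatou argument: on a finite set the energies of the truncated maximal functions
  converge, and all are at most \<open>R\<close>. Passing from \<open>u\<close> to its absolute
  value does not increase any partial difference.\<close>

lemma poisson_max_energy_le:
  fixes u :: "int ^ 'd::finite \<Rightarrow> real"
  assumes p: "1 \<le> p" "p = 2 \<or> CARD('d) = 1"
    and bdd: "bounded (range u)"
    and summable: "(\<lambda>n. \<Sum>i\<in>UNIV. \<bar>partial_diff i u n\<bar> powr p) summable_on UNIV"
  shows "(\<lambda>n. \<Sum>i\<in>UNIV. \<bar>partial_diff i (poisson_max u) n\<bar> powr p) summable_on UNIV"
    and "(\<Sum>\<^sub>\<infinity>n. \<Sum>i\<in>UNIV. \<bar>partial_diff i (poisson_max u) n\<bar> powr p)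
        \<le> (\<Sum>\<^sub>\<infinity>n. \<Sum>i\<in>UNIV. \<bar>partial_diff i u n\<bar> powr p)"
proof -
  obtain C where C: "\<And>n. \<bar>u n\<bar> \<le> C"
    using bdd by (auto simp: bounded_iff)
  define f where "f = (\<lambda>m. \<bar>u m\<bar>)"
  define R where "R = (\<Sum>\<^sub>\<infinity>n. \<Sum>i\<in>UNIV. \<bar>partial_diff i u n\<bar> powr p)"
  have f: "0 \<le> f n" "f n \<le> C" for n using C by (auto simp: f_def)
  have f_le_u: "\<bar>partial_diff i f n\<bar> powr p \<le> \<bar>partial_diff i u n\<bar> powr p" for i n
    using p by (intro powr_mono2) (auto simp: f_def partial_diff_def)
  have f_sum_le: "(\<Sum>i\<in>UNIV. \<bar>partial_diff i f n\<bar> powr p) \<le> (\<Sum>i\<in>UNIV. \<bar>partial_diff i u n\<bar> powr p)" for n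
    by (intro sum_mono f_le_u)
  have f_summable: "lp_summable p (partial_diff i f)" for i
    unfolding lp_summable_def
  proof (rule summable_on_comparison_test[OF summable])
    show "\<bar>partial_diff i f n\<bar> powr p \<le> (\<Sum>i\<in>UNIV. \<bar>partial_diff i u n\<bar> powr p)" for n
      using member_le_sum[of i UNIV "\<lambda>i. \<bar>partial_diff i u n\<bar> powr p"]
      by (intro order_trans[OF f_le_u]) auto
  qed simp
  have "(\<lambda>n. \<Sum>i\<in>UNIV. \<bar>partial_diff i f n\<bar> powr p) summable_on UNIV"
    by (rule summable_on_comparison_test[OF summable f_sum_le]) (simp add: sum_nonneg)
  then have f_R: "(\<Sum>\<^sub>\<infinity>n. \<Sum>i\<in>UNIV. \<bar>partial_diff i f n\<bar> powr p) \<le> R"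
    unfolding R_def by (rule infsum_mono[OF _ summable f_sum_le])
  have M_subharmonic: "0 \<le> (\<Sum>i\<in>UNIV. abs_powr_deriv p (partial_diff i (walk_max f t) n)
      - abs_powr_deriv p (partial_diff i (walk_max f t) (n - axis i 1)))"
    if "f n < walk_max f t n" for t n
    by (intro abs_powr_deriv_sum_nonneg p walk_max_subharmonic[OF f that])
  note M_energy = energy_le_of_subharmonic[OF p(1) le_walk_max[OF f]
      lp_summable_walk_max_diff[OF f order_trans[OF zero_le_one p(1)] f_summable] f_summable M_subharmonic]
  have finite_le: "(\<Sum>n\<in>F. \<Sum>i\<in>UNIV. \<bar>partial_diff i (poisson_max u) n\<bar> powr p) \<le> R" if "finite F" for F
  proof (rule LIMSEQ_le_const2)
    have "(\<lambda>t. \<bar>partial_diff i (walk_max f t) n\<bar> powr p)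
        \<longlonglongrightarrow> \<bar>partial_diff i (poisson_max u) n\<bar> powr p" for i n
      unfolding partial_diff_def f_def using p
      by (intro tendsto_powr' tendsto_rabs tendsto_diff tendsto_const walk_max_tendsto_poisson_max[OF C]) auto
    then show "(\<lambda>t. \<Sum>n\<in>F. \<Sum>i\<in>UNIV. \<bar>partial_diff i (walk_max f t) n\<bar> powr p)
        \<longlonglongrightarrow> (\<Sum>n\<in>F. \<Sum>i\<in>UNIV. \<bar>partial_diff i (poisson_max u) n\<bar> powr p)"
      by (intro tendsto_sum)
    have "(\<Sum>n\<in>F. \<Sum>i\<in>UNIV. \<bar>partial_diff i (walk_max f t) n\<bar> powr p) \<le> R" for t
      using finite_sum_le_infsum[OF M_energy(1)[of t] that] M_energy(2)[of t] f_R
      by (fastforce intro: sum_nonneg)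
    then show "\<exists>N. \<forall>t\<ge>N. (\<Sum>n\<in>F. \<Sum>i\<in>UNIV. \<bar>partial_diff i (walk_max f t) n\<bar> powr p) \<le> R"
      by blast
  qed
  show summable': "(\<lambda>n. \<Sum>i\<in>UNIV. \<bar>partial_diff i (poisson_max u) n\<bar> powr p) summable_on UNIV"
    using finite_le
    by (intro nonneg_bdd_above_summable_on bdd_aboveI[where M = R]) (auto intro: sum_nonneg)
  show "(\<Sum>\<^sub>\<infinity>n. \<Sum>i\<in>UNIV. \<bar>partial_diff i (poisson_max u) n\<bar> powr p)
      \<le> (\<Sum>\<^sub>\<infinity>n. \<Sum>i\<in>UNIV. \<bar>partial_diff i u n\<bar> powr p)"
    unfolding R_def[symmetric] by (rule infsum_le_finite_sums[OF summable']) (use finite_le in auto)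
qed

text \<open>Summability is demanded together with the inequality: without it \<open>lp_norm\<close>
  is infinite, while the infinite sum defaults to 0.\<close>

lemma lp_norm_le_lp_norm:
  assumes "p \<noteq> \<infinity>" "lp_norm p g < \<infinity>"
    and "(\<lambda>n. norm (g n) powr enn2real p) summable_on UNIV \<Longrightarrow>
      (\<lambda>n. norm (f n) powr enn2real p) summable_on UNIV \<and>
      (\<Sum>\<^sub>\<infinity>n. norm (f n) powr enn2real p) \<le> (\<Sum>\<^sub>\<infinity>n. norm (g n) powr enn2real p)"
  shows "lp_norm p f \<le> lp_norm p g"
proof -
  have g: "(\<lambda>n. norm (g n) powr enn2real p) summable_on UNIV"
    using assms(1,2) by (auto simp: lp_norm_def split: if_splits)
  from assms(3)[OF this] show ?thesis
    using g assms(1) by (auto simp: lp_norm_def infsum_nonneg intro!: ennreal_leI powr_mono2)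
qed

section \<open>From energies to the norms of the statement\<close>

lemma norm_grad_powr_2: "norm (grad u n) powr 2 = (\<Sum>i\<in>UNIV. \<bar>partial_diff i u n\<bar> powr 2)"
  by (simp add: norm_vec_def L2_set_def grad_def sum_nonneg)

lemma bij_vec_1: "bij_betw (vec :: 'a \<Rightarrow> 'a ^ 1) UNIV UNIV"
  by (rule bij_betwI[where g = "\<lambda>m. m $ 1"]) (auto simp: vec_eq_iff forall_1)

lemma diff1_eq_partial_diff: "diff1 (\<lambda>k. g (vec k)) n = partial_diff (1 :: 1) g (vec n)"
proof -
  have "vec (n + 1) = vec n + (axis 1 1 :: int ^ 1)"
    by (simp add: vec_eq_iff forall_1)
  then show ?thesis by (simp add: diff1_def partial_diff_def)
qed

theorem theorem4:
  shows "(\<forall>(p :: ennreal) (u0 :: int \<Rightarrow> real).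
            1 \<le> p \<and> bounded (range u0) \<and> lp_norm p (diff1 u0) < \<infinity> \<longrightarrow>
            lp_norm p (diff1 (poisson_max1 u0)) \<le> lp_norm p (diff1 u0))
       \<and> (\<forall>u0 :: int ^ 'd::finite \<Rightarrow> real.
            bounded (range u0) \<and> lp_norm 2 (grad u0) < \<infinity> \<longrightarrow>
            lp_norm 2 (grad (poisson_max u0)) \<le> lp_norm 2 (grad u0))"
proof (intro conjI allI impI; elim conjE)
  fix p :: ennreal and u0 :: "int \<Rightarrow> real"
  assume p: "1 \<le> p" and bdd: "bounded (range u0)" and fin: "lp_norm p (diff1 u0) < \<infinity>"
  define v :: "int ^ 1 \<Rightarrow> real" where "v m = u0 (m $ 1)" for m
  have "range v \<subseteq> range u0" by (auto simp: v_def)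
  then have bdd_v: "bounded (range v)" by (rule bounded_subset[OF bdd])
  have u0: "diff1 u0 = (\<lambda>n. partial_diff 1 v (vec n))"
    by (simp add: fun_eq_iff diff1_eq_partial_diff[symmetric] v_def)
  have "poisson_max1 u0 = (\<lambda>k. poisson_max v (vec k))"
    by (simp add: fun_eq_iff poisson_max1_def v_def[abs_def])
  then have max_u0: "diff1 (poisson_max1 u0) = (\<lambda>n. partial_diff 1 (poisson_max v) (vec n))"
    by (intro ext) (simp only: diff1_eq_partial_diff)
  show "lp_norm p (diff1 (poisson_max1 u0)) \<le> lp_norm p (diff1 u0)"
  proof (cases "p = \<infinity>")
    case True
    \<comment> \<open>The finite supremum norm serves as a Lipschitz constant, which the maximal
      function inherits.\<close>
    define S where "S = (SUP n. ennreal \<bar>diff1 u0 n\<bar>)"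
    have norm_u0: "lp_norm p (diff1 u0) = S" by (simp add: lp_norm_def True S_def)
    with fin have S: "ennreal (enn2real S) = S" by (simp add: less_top)
    have "\<bar>partial_diff 1 v m\<bar> \<le> enn2real S" for m
    proof -
      have "ennreal \<bar>diff1 u0 (m $ 1)\<bar> \<le> ennreal (enn2real S)"
        unfolding S unfolding S_def by (rule SUP_upper) simp
      moreover have "vec (m $ 1) = m" by (simp add: vec_eq_iff forall_1)
      ultimately show ?thesis by (simp add: u0)
    qed
    then have "\<bar>diff1 (poisson_max1 u0) n\<bar> \<le> enn2real S" for n
      unfolding max_u0 by (rule partial_diff_poisson_max_bound[OF bdd_v])
    then have "ennreal \<bar>diff1 (poisson_max1 u0) n\<bar> \<le> S" for n
      by (subst S[symmetric]) (rule ennreal_leI)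
    then show ?thesis
      unfolding norm_u0 by (simp add: lp_norm_def True SUP_least)
  next
    case False
    then have "p < top" by (simp add: less_top)
    then have r: "1 \<le> enn2real p" using enn2real_mono[OF p] by simp
    show ?thesis
    proof (rule lp_norm_le_lp_norm[OF False fin])
      \<comment> \<open>On \<open>int ^ 1\<close> the energy has a single summand, and reindexing
        along \<open>vec\<close> turns sums over the integers into sums over the lattice.\<close>
      let ?E = "\<lambda>g n. \<Sum>i\<in>UNIV. \<bar>partial_diff (i :: 1) g n\<bar> powr enn2real p"
      have E: "norm (partial_diff 1 g (vec n)) powr enn2real p = ?E g (vec n)" for g n
        by (simp add: sum_1)
      assume "(\<lambda>n. norm (diff1 u0 n) powr enn2real p) summable_on UNIV"
      then have "?E v summable_on UNIV"
        unfolding u0 E summable_on_reindex_bij_betw[OF bij_vec_1, of "?E v"] .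
      from poisson_max_energy_le[OF r _ bdd_v this]
      show "(\<lambda>n. norm (diff1 (poisson_max1 u0) n) powr enn2real p) summable_on UNIV \<and>
          (\<Sum>\<^sub>\<infinity>n. norm (diff1 (poisson_max1 u0) n) powr enn2real p)
              \<le> (\<Sum>\<^sub>\<infinity>n. norm (diff1 u0 n) powr enn2real p)"
        unfolding max_u0 u0 E summable_on_reindex_bij_betw[OF bij_vec_1, of "?E (poisson_max v)"]
          infsum_reindex_bij_betw[OF bij_vec_1, of "?E (poisson_max v)"]
          infsum_reindex_bij_betw[OF bij_vec_1, of "?E v"]
        by simp
    qed
  qed
next
  fix u0 :: "int ^ 'd \<Rightarrow> real"
  assume bdd: "bounded (range u0)" and fin: "lp_norm 2 (grad u0) < \<infinity>"
  show "lp_norm 2 (grad (poisson_max u0)) \<le> lp_norm 2 (grad u0)"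
  proof (rule lp_norm_le_lp_norm[OF _ fin])
    assume "(\<lambda>n. norm (grad u0 n) powr enn2real 2) summable_on UNIV"
    then show "(\<lambda>n. norm (grad (poisson_max u0) n) powr enn2real 2) summable_on UNIV \<and>
        (\<Sum>\<^sub>\<infinity>n. norm (grad (poisson_max u0) n) powr enn2real 2)
            \<le> (\<Sum>\<^sub>\<infinity>n. norm (grad u0 n) powr enn2real 2)"
      using poisson_max_energy_le[of 2 u0] bdd
      by (simp only: enn2real_numeral norm_grad_powr_2) simp
  qed simp
qed

end
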